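(* Let $k\ge1$ and $g,n\ge0$, and let $\widehat r_k:B_k(\widehat\Sigma_{g,n})\to B_k(\widehat\Sigma_{g,n})/\Gamma_2(B_k(\widehat\Sigma_{g,n}))$ be the canonical projection. The group $B_k(\widehat\Sigma_{g,n})/\Gamma_2(B_k(\widehat\Sigma_{g,n}))$ admits the following presentation. Generating set: $\widehat r_k(S\cup AB\cup Z)=\{\sigma\}\cup AB\cup Z$ (all elements of $S$ being mapped to $\sigma$, and elements of $AB\cup Z$ keeping their names). Relations: $xy=yx$ for all distinct $x,y\in\{\sigma\}\cup AB\cup Z$; and, if $g\ge1$, $\sigma^2=1$. Consequently, $B_k(\mathbb D_n)/\Gamma_2(B_k(\mathbb D_n))$ is free Abelian on the set $\widehat r_k(S\cup Z)=\{\sigma\}\cup Z$, and if $g\ge1$, the group $B_k(\widehat\Sigma_{g,n})/\Gamma_2(B_k(\widehat\Sigma_{g,n}))$ is isomorphic to $\mathbb Z^{2g+n}\times\mathbb Z_2$ if $k\ge2$ and to $\mathbb Z^{2g+n}$ if $k=1$.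
   Context: Convention: if $k=1$ (resp. $n=0$, $g=0$) then the element $\sigma$ and the set $S$ (resp. the set $Z$, the set $AB$) and all relations involving them are suppressed. For a connected surface $\Sigma$, $B_k(\Sigma)=\pi_1(\mathbb F_k(\Sigma)/S_k)$, where $\mathbb F_k(\Sigma)=\{(x_1,\dots,x_k)\in\Sigma^k: x_i\neq x_j\ (i\ne j)\}$. $\widehat\Sigma_g$ is a compact connected orientable surface of genus $g$ with one boundary component, $\widehat\Sigma_{g,n}$ is $\widehat\Sigma_g$ minus $n$ interior points; $\mathbb D_n=\widehat\Sigma_{0,n}$ is the disc minus $n$ interior points. $\Gamma_2(G)=[G,G]$; $\mathbb Z_2=\mathbb Z/2\mathbb Z$. Known presentation of $B_k(\widehat\Sigma_{g,n})$: generators $S=\{\sigma_1,\dots,\sigma_{k-1}\}$, $AB=\{a_1,b_1,\dots,a_g,b_g\}$, $Z=\{\zeta_1,\dots,\zeta_n\}$; write $c<d$ for $c\in\{a_i,b_i\}$, $d\in\{a_j,b_j\}$, $i<j$. Relations: $\sigma_i\sigma_j=\sigma_j\sigma_i$ for $|i-j|\ge2$; $\sigma_i\sigma_{i+1}\sigma_i=\sigma_{i+1}\sigma_i\sigma_{i+1}$; $c\sigma_i=\sigma_ic$ for $i\neq1$, $c\in AB\cup Z$; $c\sigma_1c\sigma_1=\sigma_1c\sigma_1c$ for $c\in AB\cup Z$; $a_i\sigma_1b_i=\sigma_1b_i\sigma_1a_i\sigma_1$; $\sigma_1^{-1}c\sigma_1$ commutes with $d$ for $c,d\in AB$, $c<d$;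 $\sigma_1^{-1}\zeta_i\sigma_1$ commutes with every $c\in AB$, and with $\zeta_j$ for $i<j$. *)

theory Defs
  imports
    "HOL-Complex_Analysis.Winding_Numbers"
    "HOL-Algebra.Free_Abelian_Groups"
    "HOL-Algebra.Generated_Groups"
    "HOL-Combinatorics.Permutations"
begin

section \<open>Surfaces\<close>

definition planar_chart :: "'a topology \<Rightarrow> 'a set \<Rightarrow> ('a \<Rightarrow> complex) \<Rightarrow> bool" where
  "planar_chart X U h \<longleftrightarrow> openin X U \<and>
     (\<exists>V. open V \<and> homeomorphic_map (subtopology X U) (top_of_set V) h)"

definition half_plane_chart :: "'a topology \<Rightarrow> 'a set \<Rightarrow> ('a \<Rightarrow> complex) \<Rightarrow> bool" where
  "half_plane_chart X U h \<longleftrightarrow> openin X U \<and>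
     (\<exists>V. openin (top_of_set {z. 0 \<le> Im z}) V \<and> homeomorphic_map (subtopology X U) (top_of_set V) h)"

definition surface_with_boundary :: "'a topology \<Rightarrow> bool" where
  "surface_with_boundary X \<longleftrightarrow> Hausdorff_space X \<and> second_countable X \<and>
     (\<forall>x\<in>topspace X. \<exists>U h. x \<in> U \<and> half_plane_chart X U h)"

definition surface_interior :: "'a topology \<Rightarrow> 'a set" where
  "surface_interior X = {x. \<exists>U h. x \<in> U \<and> planar_chart X U h}"

definition surface_boundary :: "'a topology \<Rightarrow> 'a set" where
  "surface_boundary X = topspace X - surface_interior X"

text \<open>For a homeomorphism \<open>f\<close> between open subsets of the plane, the domain being \<open>W\<close>, to preserve
  the orientation means to have local degree one, i.e. the image of a positively oriented circle
  bounding a disc in \<open>W\<close> winds exactly once around the image of the centre.\<close>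
definition orientation_preserving_on :: "complex set \<Rightarrow> (complex \<Rightarrow> complex) \<Rightarrow> bool" where
  "orientation_preserving_on W f \<longleftrightarrow>
     (\<forall>z r. 0 < r \<and> cball z r \<subseteq> W \<longrightarrow> winding_number (f \<circ> circlepath z r) (f z) = 1)"

text \<open>Orientability of a surface with boundary is orientability of its interior.\<close>
definition orientable_surface :: "'a topology \<Rightarrow> bool" where
  "orientable_surface X \<longleftrightarrow>
     (\<exists>\<A>. (\<forall>(U, h)\<in>\<A>. planar_chart X U h) \<and> (\<Union>(U, h)\<in>\<A>. U) = surface_interior X \<and>
        (\<forall>(U, h)\<in>\<A>. \<forall>(V, k)\<in>\<A>. orientation_preserving_on (h ` (U \<inter> V)) (k \<circ> inv_into U h)))"

definition simple_closed_curve_in :: "'a topology \<Rightarrow> 'a set \<Rightarrow> bool" where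
  "simple_closed_curve_in X C \<longleftrightarrow>
     (\<exists>f. embedding_map (top_of_set (sphere (0::complex) 1)) X f \<and> C = f ` sphere 0 1)"

definition has_nonseparating_curves :: "'a topology \<Rightarrow> nat \<Rightarrow> bool" where
  "has_nonseparating_curves X m \<longleftrightarrow>
     (\<exists>\<C>. finite \<C> \<and> card \<C> = m \<and> pairwise disjnt \<C> \<and>
        (\<forall>C\<in>\<C>. simple_closed_curve_in X C \<and> C \<subseteq> surface_interior X) \<and>
        connected_space (subtopology X (topspace X - \<Union>\<C>)))"

text \<open>The genus of a connected orientable surface: the maximal number of disjoint simple closed
  curves along which it can be cut without becoming disconnected. The curves have to avoid the
  boundary, since a boundary circle never separates.\<close>
definition has_genus :: "'a topology \<Rightarrow> nat \<Rightarrow> bool" where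
  "has_genus X g \<longleftrightarrow> has_nonseparating_curves X g \<and> (\<forall>m. has_nonseparating_curves X m \<longrightarrow> m \<le> g)"

text \<open>\<open>X\<close> is a compact connected orientable surface of genus \<open>g\<close> with one boundary component.\<close>
definition bounded_surface :: "nat \<Rightarrow> 'a topology \<Rightarrow> bool" where
  "bounded_surface g X \<longleftrightarrow> surface_with_boundary X \<and> compact_space X \<and> connected_space X \<and>
     orientable_surface X \<and> has_genus X g \<and>
     card (connected_components_of (subtopology X (surface_boundary X))) = 1"

definition punctured_bounded_surface :: "nat \<Rightarrow> nat \<Rightarrow> 'a topology \<Rightarrow> bool" where
  "punctured_bounded_surface g n Y \<longleftrightarrow>
     (\<exists>X P. bounded_surface g X \<and> finite P \<and> card P = n \<and> P \<subseteq> surface_interior X \<and>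
        Y = subtopology X (topspace X - P))"


section \<open>Configuration spaces\<close>

definition ordered_config_space :: "nat \<Rightarrow> 'a topology \<Rightarrow> (nat \<Rightarrow> 'a) topology" where
  "ordered_config_space k X = subtopology (product_topology (\<lambda>_. X) {..<k}) {x. inj_on x {..<k}}"

definition quotient_topology :: "'a topology \<Rightarrow> ('a \<Rightarrow> 'b) \<Rightarrow> 'b topology" where
  "quotient_topology X f =
     topology (\<lambda>U. U \<subseteq> f ` topspace X \<and> openin X {x \<in> topspace X. f x \<in> U})"

lemma istopology_quotient_topology:
  "istopology (\<lambda>U. U \<subseteq> f ` topspace X \<and> openin X {x \<in> topspace X. f x \<in> U})"
  unfolding istopology_def
proof (intro conjI allI impI)
  fix S T
  assume "S \<subseteq> f ` topspace X \<and> openin X {x \<in> topspace X. f x \<in> S}"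
    "T \<subseteq> f ` topspace X \<and> openin X {x \<in> topspace X. f x \<in> T}"
  then have "openin X ({x \<in> topspace X. f x \<in> S} \<inter> {x \<in> topspace X. f x \<in> T})"
    by (intro openin_Int) auto
  then show "openin X {x \<in> topspace X. f x \<in> S \<inter> T}"
    by (rule back_subst[of "openin X"]) auto
next
  fix K assume K: "\<forall>U\<in>K. U \<subseteq> f ` topspace X \<and> openin X {x \<in> topspace X. f x \<in> U}"
  then have "openin X (\<Union>U\<in>K. {x \<in> topspace X. f x \<in> U})"
    by blast
  then show "openin X {x \<in> topspace X. f x \<in> \<Union> K}"
    by (rule back_subst[of "openin X"]) auto
qed blast+

lemma openin_quotient_topology:
  "openin (quotient_topology X f) U \<longleftrightarrow>
     U \<subseteq> f ` topspace X \<and> openin X {x \<in> topspace X. f x \<in> U}"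
  unfolding quotient_topology_def topology_inverse'[OF istopology_quotient_topology] ..

lemma topspace_quotient_topology [simp]: "topspace (quotient_topology X f) = f ` topspace X"
proof (rule antisym)
  show "topspace (quotient_topology X f) \<subseteq> f ` topspace X"
    using openin_topspace[of "quotient_topology X f"] unfolding openin_quotient_topology by blast
  have "{x \<in> topspace X. f x \<in> f ` topspace X} = topspace X" by auto
  then show "f ` topspace X \<subseteq> topspace (quotient_topology X f)"
    by (intro openin_subset) (simp add: openin_quotient_topology)
qed

lemma quotient_map_quotient_topology: "quotient_map X (quotient_topology X f) f"
  unfolding quotient_map_def by (simp add: openin_quotient_topology)

definition perm_orbit :: "nat \<Rightarrow> (nat \<Rightarrow> 'a) \<Rightarrow> (nat \<Rightarrow> 'a) set" where
  "perm_orbit k x = {x \<circ> \<pi> | \<pi>. \<pi> permutes {..<k}}"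

definition unordered_config_space :: "nat \<Rightarrow> 'a topology \<Rightarrow> (nat \<Rightarrow> 'a) set topology" where
  "unordered_config_space k X = quotient_topology (ordered_config_space k X) (perm_orbit k)"


section \<open>The fundamental group\<close>

definition loops :: "'a topology \<Rightarrow> 'a \<Rightarrow> (real \<Rightarrow> 'a) set" where
  "loops X p = {f. pathin X f \<and> f 0 = p \<and> f 1 = p}"

definition loop_homotopic :: "'a topology \<Rightarrow> 'a \<Rightarrow> (real \<Rightarrow> 'a) \<Rightarrow> (real \<Rightarrow> 'a) \<Rightarrow> bool" where
  "loop_homotopic X p = homotopic_with (\<lambda>h. h 0 = p \<and> h 1 = p) (top_of_set {0..1}) X"

definition loop_class :: "'a topology \<Rightarrow> 'a \<Rightarrow> (real \<Rightarrow> 'a) \<Rightarrow> (real \<Rightarrow> 'a) set" where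
  "loop_class X p f = {g. loop_homotopic X p f g}"

text \<open>The library's path concatenation requires the points to form a topological-space type.\<close>
definition loop_join :: "(real \<Rightarrow> 'a) \<Rightarrow> (real \<Rightarrow> 'a) \<Rightarrow> real \<Rightarrow> 'a" where
  "loop_join f g = (\<lambda>t. if t \<le> 1/2 then f (2 * t) else g (2 * t - 1))"

definition fundamental_group :: "'a topology \<Rightarrow> 'a \<Rightarrow> (real \<Rightarrow> 'a) set monoid" where
  "fundamental_group X p =
     \<lparr>carrier = loop_class X p ` loops X p,
      monoid.mult = (\<lambda>a b. \<Union>f\<in>a. \<Union>g\<in>b. loop_class X p (loop_join f g)),
      one = loop_class X p (\<lambda>_. p)\<rparr>"

lemma loop_homotopic_iff:
  "loop_homotopic X p f g \<longleftrightarrow>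
     (\<exists>h. continuous_map (top_of_set ({0..1::real} \<times> {0..1})) X h \<and>
        (\<forall>s\<in>{0..1}. h (0, s) = f s) \<and> (\<forall>s\<in>{0..1}. h (1, s) = g s) \<and>
        (\<forall>t\<in>{0..1}. h (t, 0) = p \<and> h (t, 1) = p))"
proof -
  have "prod_topology (top_of_set {0..1::real}) (top_of_set {0..1::real}) = top_of_set ({0..1} \<times> {0..1})"
    by (simp flip: subtopology_Times)
  then show ?thesis
    unfolding loop_homotopic_def by (subst homotopic_with) simp_all
qed

lemma loop_homotopic_sym: "loop_homotopic X p f g \<Longrightarrow> loop_homotopic X p g f"
  unfolding loop_homotopic_def by (simp add: homotopic_with_sym)

lemma loop_homotopic_trans:
  "loop_homotopic X p f g \<Longrightarrow> loop_homotopic X p g h \<Longrightarrow> loop_homotopic X p f h"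
  unfolding loop_homotopic_def by (rule homotopic_with_trans)

lemma loop_homotopic_refl: "loop_homotopic X p f f \<longleftrightarrow> f \<in> loops X p"
  unfolding loop_homotopic_def loops_def pathin_def by simp

lemma loop_homotopic_loops:
  assumes "loop_homotopic X p f g"
  shows "f \<in> loops X p" "g \<in> loops X p"
proof -
  show "f \<in> loops X p"
    using loop_homotopic_trans[OF assms loop_homotopic_sym[OF assms]] by (simp only: loop_homotopic_refl)
  show "g \<in> loops X p"
    using loop_homotopic_trans[OF loop_homotopic_sym[OF assms] assms] by (simp only: loop_homotopic_refl)
qed

lemma continuous_map_top_of_set_compose:
  assumes "continuous_map (top_of_set S) X f" "continuous_on T \<phi>" "\<And>x. x \<in> T \<Longrightarrow> \<phi> x \<in> S"
  shows "continuous_map (top_of_set T) X (\<lambda>x. f (\<phi> x))"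
proof -
  have "continuous_map (top_of_set T) (top_of_set S) \<phi>"
    using assms(2,3) by auto
  from continuous_map_compose[OF this assms(1)] show ?thesis
    by (simp add: o_def)
qed

lemma loop_homotopic_reparam:
  assumes f: "f \<in> loops X p"
    and c: "continuous_on {0..1} \<phi>" "continuous_on {0..1} \<psi>"
    and i: "\<And>s. s \<in> {0..1} \<Longrightarrow> \<phi> s \<in> {0..1}" "\<And>s. s \<in> {0..1} \<Longrightarrow> \<psi> s \<in> {0..1::real}"
    and e: "\<phi> 0 = \<psi> 0" "\<phi> 1 = \<psi> 1" "f (\<phi> 0) = p" "f (\<phi> 1) = p"
    and F: "\<And>s. s \<in> {0..1} \<Longrightarrow> F s = f (\<phi> s)" and G: "\<And>s. s \<in> {0..1} \<Longrightarrow> G s = f (\<psi> s)"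
  shows "loop_homotopic X p F G"
  unfolding loop_homotopic_iff
proof (intro exI conjI ballI)
  let ?c = "\<lambda>x. (1 - fst x) * \<phi> (snd x) + fst x * \<psi> (snd x)"
  show "continuous_map (top_of_set ({0..1} \<times> {0..1})) X (f \<circ> ?c)"
    unfolding o_def
  proof (rule continuous_map_top_of_set_compose)
    show "continuous_map (top_of_set {0..1}) X f"
      using f by (simp add: loops_def pathin_def)
    show "continuous_on ({0..1} \<times> {0..1}) ?c"
      by (intro continuous_intros continuous_on_compose2[OF c(1)] continuous_on_compose2[OF c(2)]) auto
    show "?c x \<in> {0..1}" if "x \<in> {0..1} \<times> {0..1}" for x
    proof -
      have "?c x = (1 - fst x) *\<^sub>R \<phi> (snd x) + fst x *\<^sub>R \<psi> (snd x)"
        by simp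
      also have "\<dots> \<in> {0..1}"
        using that by (intro convexD[OF convex_real_interval(5)] i) auto
      finally show ?thesis .
    qed
  qed
  fix s :: real assume s: "s \<in> {0..1}"
  show "(f \<circ> ?c) (0, s) = F s" "(f \<circ> ?c) (1, s) = G s"
    by (simp_all only: F[OF s] G[OF s] o_apply fst_conv snd_conv) simp_all
  have "?c (s, 0) = \<phi> 0" "?c (s, 1) = \<phi> 1"
    by (simp_all only: e(1,2)[symmetric] fst_conv snd_conv) (simp_all add: algebra_simps)
  then show "(f \<circ> ?c) (s, 0) = p" "(f \<circ> ?c) (s, 1) = p"
    by (simp_all only: e(3,4) o_apply)
qed

lemma loop_homotopic_join:
  assumes "loop_homotopic X p f f'" "loop_homotopic X p g g'"
  shows "loop_homotopic X p (loop_join f g) (loop_join f' g')"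
proof -
  obtain H where H: "continuous_map (top_of_set ({0..1::real} \<times> {0..1::real})) X H"
      "\<And>s. s \<in> {0..1} \<Longrightarrow> H (0, s) = f s" "\<And>s. s \<in> {0..1} \<Longrightarrow> H (1, s) = f' s"
      "\<And>t. t \<in> {0..1} \<Longrightarrow> H (t, 0) = p" "\<And>t. t \<in> {0..1} \<Longrightarrow> H (t, 1) = p"
    using assms(1) unfolding loop_homotopic_iff by auto
  obtain K where K: "continuous_map (top_of_set ({0..1::real} \<times> {0..1::real})) X K"
      "\<And>s. s \<in> {0..1} \<Longrightarrow> K (0, s) = g s" "\<And>s. s \<in> {0..1} \<Longrightarrow> K (1, s) = g' s"
      "\<And>t. t \<in> {0..1} \<Longrightarrow> K (t, 0) = p" "\<And>t. t \<in> {0..1} \<Longrightarrow> K (t, 1) = p"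
    using assms(2) unfolding loop_homotopic_iff by auto
  let ?Q = "{0..1::real} \<times> {0..1::real}"
  have sub: "subtopology (top_of_set ?Q) {x \<in> topspace (top_of_set ?Q). snd x \<le> 1/2} =
      top_of_set {x \<in> ?Q. snd x \<le> 1/2}"
      "subtopology (top_of_set ?Q) {x \<in> topspace (top_of_set ?Q). 1/2 \<le> snd x} =
      top_of_set {x \<in> ?Q. 1/2 \<le> snd x}"
    by (auto simp: subtopology_subtopology intro: arg_cong[where f=top_of_set])
  show ?thesis
    unfolding loop_homotopic_iff
  proof (intro exI conjI ballI)
    show "continuous_map (top_of_set ?Q) X
        (\<lambda>x. if snd x \<le> 1/2 then H (fst x, 2 * snd x) else K (fst x, 2 * snd x - 1))"
    proof (rule continuous_map_cases_le)
      show "continuous_map (top_of_set ?Q) euclideanreal snd"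
        "continuous_map (top_of_set ?Q) euclideanreal (\<lambda>x. 1/2)"
        by (auto intro!: continuous_intros)
      show "continuous_map (subtopology (top_of_set ?Q) {x \<in> topspace (top_of_set ?Q). snd x \<le> 1/2}) X
          (\<lambda>x. H (fst x, 2 * snd x))"
        unfolding sub by (rule continuous_map_top_of_set_compose[OF H(1)]) (auto intro!: continuous_intros)
      show "continuous_map (subtopology (top_of_set ?Q) {x \<in> topspace (top_of_set ?Q). 1/2 \<le> snd x}) X
          (\<lambda>x. K (fst x, 2 * snd x - 1))"
        unfolding sub by (rule continuous_map_top_of_set_compose[OF K(1)]) (auto intro!: continuous_intros)
      show "H (fst x, 2 * snd x) = K (fst x, 2 * snd x - 1)"
        if x: "x \<in> topspace (top_of_set ?Q)" "snd x = 1/2" for x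
      proof -
        have t: "fst x \<in> {0..1}"
          using x(1) by (metis mem_Times_iff topspace_euclidean_subtopology)
        have "2 * snd x = 1" "2 * snd x - 1 = 0"
          using x(2) by linarith+
        then show ?thesis
          using H(5)[OF t] K(4)[OF t] by metis
      qed
    qed
    fix s :: real assume s: "s \<in> {0..1}"
    show "(if snd (0::real, s) \<le> 1/2 then H (fst (0::real, s), 2 * snd (0::real, s))
        else K (fst (0::real, s), 2 * snd (0::real, s) - 1)) = loop_join f g s"
      using s H(2)[of "2 * s"] K(2)[of "2 * s - 1"] by (simp add: loop_join_def)
    show "(if snd (1::real, s) \<le> 1/2 then H (fst (1::real, s), 2 * snd (1::real, s))
        else K (fst (1::real, s), 2 * snd (1::real, s) - 1)) = loop_join f' g' s"
      using s H(3)[of "2 * s"] K(3)[of "2 * s - 1"] by (simp add: loop_join_def)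
    show "(if snd (s, 0::real) \<le> 1/2 then H (fst (s, 0::real), 2 * snd (s, 0::real))
        else K (fst (s, 0::real), 2 * snd (s, 0::real) - 1)) = p"
      using H(4)[OF s] by simp
    show "(if snd (s, 1::real) \<le> 1/2 then H (fst (s, 1::real), 2 * snd (s, 1::real))
        else K (fst (s, 1::real), 2 * snd (s, 1::real) - 1)) = p"
      using K(5)[OF s] by simp
  qed
qed

lemma loop_join_loops: "f \<in> loops X p \<Longrightarrow> g \<in> loops X p \<Longrightarrow> loop_join f g \<in> loops X p"
  using loop_homotopic_join loop_homotopic_refl by metis

lemma loop_class_eq:
  assumes "loop_homotopic X p f g"
  shows "loop_class X p f = loop_class X p g"
proof -
  have "loop_homotopic X p f h \<longleftrightarrow> loop_homotopic X p g h" for h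
    using loop_homotopic_trans[OF assms] loop_homotopic_trans[OF loop_homotopic_sym[OF assms]] by iprover
  then show ?thesis
    by (simp only: loop_class_def)
qed

lemma fundamental_group_mult:
  assumes "f \<in> loops X p" "g \<in> loops X p"
  shows "loop_class X p f \<otimes>\<^bsub>fundamental_group X p\<^esub> loop_class X p g = loop_class X p (loop_join f g)"
proof -
  let ?A = "loop_class X p f" and ?B = "loop_class X p g" and ?C = "loop_class X p (loop_join f g)"
  have eq: "loop_class X p (loop_join f' g') = ?C" if "f' \<in> ?A" "g' \<in> ?B" for f' g'
  proof -
    have "loop_homotopic X p f f'" "loop_homotopic X p g g'"
      using that by (simp_all add: loop_class_def)
    from loop_class_eq[OF loop_homotopic_join[OF this]] show ?thesis ..
  qed
  have ne: "?A \<noteq> {}" "?B \<noteq> {}"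
    using assms loop_homotopic_refl unfolding loop_class_def by fast+
  have "?A \<otimes>\<^bsub>fundamental_group X p\<^esub> ?B = (\<Union>f'\<in>?A. \<Union>g'\<in>?B. loop_class X p (loop_join f' g'))"
    by (simp only: fundamental_group_def monoid.simps)
  also have "\<dots> = (\<Union>f'\<in>?A. \<Union>g'\<in>?B. ?C)"
    by (intro SUP_cong[OF HOL.refl] eq)
  also have "\<dots> = ?C"
    using ne by (simp only: UN_constant if_False)
  finally show ?thesis .
qed

lemma loop_join_assoc:
  assumes "f \<in> loops X p" "g \<in> loops X p" "h \<in> loops X p"
  shows "loop_homotopic X p (loop_join (loop_join f g) h) (loop_join f (loop_join g h))"
proof (rule loop_homotopic_reparam[where f = "loop_join f (loop_join g h)" and \<psi> = "\<lambda>s. s"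
      and \<phi> = "\<lambda>s. min (2 * s) (min (s + 1/4) (s / 2 + 1/2))"])
  show "loop_join (loop_join f g) h s =
      loop_join f (loop_join g h) (min (2 * s) (min (s + 1/4) (s / 2 + 1/2)))" if "s \<in> {0..1}" for s
  proof -
    consider "s \<le> 1/4" | "1/4 < s" "s \<le> 1/2" | "1/2 < s" by linarith
    then show ?thesis
    proof cases
      case 1
      then show ?thesis using that by (simp add: loop_join_def)
    next
      case 2
      then have "min (2 * s) (min (s + 1/4) (s / 2 + 1/2)) = s + 1/4" by auto
      then show ?thesis using 2 by (simp add: loop_join_def algebra_simps)
    next
      case 3
      then have "min (2 * s) (min (s + 1/4) (s / 2 + 1/2)) = s / 2 + 1/2" using that by auto
      then show ?thesis using 3 that by (simp add: loop_join_def algebra_simps)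
    qed
  qed
  have "loop_join f (loop_join g h) \<in> loops X p"
    using assms by (intro loop_join_loops)
  then show "loop_join f (loop_join g h) \<in> loops X p"
    "loop_join f (loop_join g h) (min (2 * 0) (min (0 + 1/4) (0 / 2 + 1/2))) = p"
    "loop_join f (loop_join g h) (min (2 * 1) (min (1 + 1/4) (1 / 2 + 1/2))) = p"
    by (simp_all add: loops_def)
qed (auto intro!: continuous_intros)

lemma const_loop: "p \<in> topspace X \<Longrightarrow> (\<lambda>_. p) \<in> loops X p"
  by (simp add: loops_def)

lemma loop_join_const:
  assumes f: "f \<in> loops X p"
  shows "loop_homotopic X p (loop_join (\<lambda>_. p) f) f"
proof (rule loop_homotopic_reparam[OF f, where \<psi> = "\<lambda>s. s" and \<phi> = "\<lambda>s. max 0 (2 * s - 1)"])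
  show "continuous_on {0..1::real} (\<lambda>s. max 0 (2 * s - 1))"
    by (intro continuous_on_max continuous_on_diff continuous_on_mult continuous_on_const continuous_on_id)
  have "f 0 = p" "f 1 = p"
    using f by (simp_all add: loops_def)
  then show "loop_join (\<lambda>_. p) f s = f (max 0 (2 * s - 1))" for s
    by (cases "s \<le> 1/2") (simp_all add: loop_join_def max.absorb1 max.absorb2)
  show "f (max 0 (2 * 0 - 1)) = p" "f (max 0 (2 * 1 - 1)) = p"
    using \<open>f 0 = p\<close> \<open>f 1 = p\<close> by simp_all
qed auto

lemma loop_join_reverse:
  assumes f: "f \<in> loops X p"
  shows "loop_homotopic X p (loop_join (\<lambda>s. f (1 - s)) f) (\<lambda>_. p)"
proof -
  have p: "f 0 = p" "f 1 = p"
    using f by (simp_all add: loops_def)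
  have join: "loop_join (\<lambda>s. f (1 - s)) f s = f \<bar>1 - 2 * s\<bar>" for s
  proof (cases "s \<le> 1/2")
    case True
    then have "\<bar>1 - 2 * s\<bar> = 1 - 2 * s" by linarith
    then show ?thesis using True by (simp only: loop_join_def if_True)
  next
    case False
    then have "\<bar>1 - 2 * s\<bar> = 2 * s - 1" by linarith
    then show ?thesis using False by (simp only: loop_join_def if_False)
  qed
  have cont: "continuous_on {0..1::real} (\<lambda>s. \<bar>1 - 2 * s\<bar>)" "continuous_on {0..1::real} (\<lambda>s. 1::real)"
    by (intro continuous_on_rabs continuous_on_diff continuous_on_mult continuous_on_const continuous_on_id)+
  have range: "\<bar>1 - 2 * s\<bar> \<in> {0..1}" if "s \<in> {0..1::real}" for s
    using that unfolding atLeastAtMost_iff by linarith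
  have ends: "\<bar>1 - 2 * 0\<bar> = (1::real)" "\<bar>1 - 2 * 1\<bar> = (1::real)"
    by linarith+
  show ?thesis
  proof (rule loop_homotopic_reparam[OF f cont range])
    show "1 \<in> {0..1::real}" by simp
  qed (simp_all only: ends p join)
qed

lemma reverse_loop:
  assumes "f \<in> loops X p"
  shows "(\<lambda>s. f (1 - s)) \<in> loops X p"
proof -
  have "continuous_map (top_of_set {0..1}) X (\<lambda>s. f (1 - s))"
  proof (rule continuous_map_top_of_set_compose)
    show "continuous_map (top_of_set {0..1}) X f"
      using assms by (simp add: loops_def pathin_def)
  qed (auto intro!: continuous_on_diff continuous_on_const continuous_on_id)
  then show ?thesis
    using assms by (simp add: loops_def pathin_def)
qed

lemma group_fundamental_group:
  assumes "p \<in> topspace X"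
  shows "group (fundamental_group X p)"
proof -
  let ?G = "fundamental_group X p"
  have carr: "carrier ?G = loop_class X p ` loops X p" and one: "\<one>\<^bsub>?G\<^esub> = loop_class X p (\<lambda>_. p)"
    by (simp_all add: fundamental_group_def)
  show ?thesis
  proof (rule groupI, unfold carr one)
    show "loop_class X p (\<lambda>_. p) \<in> loop_class X p ` loops X p"
      using const_loop[OF assms] by (rule imageI)
  next
    fix a b assume "a \<in> loop_class X p ` loops X p" "b \<in> loop_class X p ` loops X p"
    then obtain f g where f: "f \<in> loops X p" "g \<in> loops X p"
      and a: "a = loop_class X p f" "b = loop_class X p g"
      by blast
    show "a \<otimes>\<^bsub>?G\<^esub> b \<in> loop_class X p ` loops X p"
      unfolding a fundamental_group_mult[OF f] using loop_join_loops[OF f] by (rule imageI)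
  next
    fix a b c
    assume "a \<in> loop_class X p ` loops X p" "b \<in> loop_class X p ` loops X p"
      "c \<in> loop_class X p ` loops X p"
    then obtain f g h where f: "f \<in> loops X p" "g \<in> loops X p" "h \<in> loops X p"
      and a: "a = loop_class X p f" "b = loop_class X p g" "c = loop_class X p h"
      by blast
    show "a \<otimes>\<^bsub>?G\<^esub> b \<otimes>\<^bsub>?G\<^esub> c = a \<otimes>\<^bsub>?G\<^esub> (b \<otimes>\<^bsub>?G\<^esub> c)"
      unfolding a by (simp only: fundamental_group_mult f loop_join_loops loop_class_eq[OF loop_join_assoc[OF f]])
  next
    fix a assume "a \<in> loop_class X p ` loops X p"
    then obtain f where f: "f \<in> loops X p" and a: "a = loop_class X p f" by blast
    show "loop_class X p (\<lambda>_. p) \<otimes>\<^bsub>?G\<^esub> a = a"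
      unfolding a fundamental_group_mult[OF const_loop[OF assms] f]
      by (rule loop_class_eq[OF loop_join_const[OF f]])
    have "loop_class X p (\<lambda>s. f (1 - s)) \<otimes>\<^bsub>?G\<^esub> a = loop_class X p (\<lambda>_. p)"
      unfolding a fundamental_group_mult[OF reverse_loop[OF f] f]
      by (rule loop_class_eq[OF loop_join_reverse[OF f]])
    then show "\<exists>b\<in>loop_class X p ` loops X p. b \<otimes>\<^bsub>?G\<^esub> a = loop_class X p (\<lambda>_. p)"
      using reverse_loop[OF f] by blast
  qed
qed

text \<open>\<open>B\<^sub>k(X)\<close>, based at the unordered configuration \<open>q\<close>.\<close>
definition surface_braid_group ::
    "nat \<Rightarrow> 'a topology \<Rightarrow> (nat \<Rightarrow> 'a) set \<Rightarrow> (real \<Rightarrow> (nat \<Rightarrow> 'a) set) set monoid" where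
  "surface_braid_group k X q = fundamental_group (unordered_config_space k X) q"


section \<open>Group presentations\<close>

text \<open>A letter \<open>(x, True)\<close> stands for the generator \<open>x\<close>, a letter \<open>(x, False)\<close> for its inverse.
  A pair \<open>(s, t)\<close> of words is used as the relation \<open>s = t\<close>.\<close>
type_synonym 'x word = "('x \<times> bool) list"

abbreviation words :: "'x set \<Rightarrow> 'x word set" where
  "words X \<equiv> lists (X \<times> UNIV)"

inductive word_equiv :: "'x set \<Rightarrow> ('x word \<times> 'x word) set \<Rightarrow> 'x word \<Rightarrow> 'x word \<Rightarrow> bool"
  for X R where
  refl: "w \<in> words X \<Longrightarrow> word_equiv X R w w"
| sym: "word_equiv X R v w \<Longrightarrow> word_equiv X R w v"
| trans: "word_equiv X R u v \<Longrightarrow> word_equiv X R v w \<Longrightarrow> word_equiv X R u w"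
| cancel: "x \<in> X \<Longrightarrow> u \<in> words X \<Longrightarrow> v \<in> words X \<Longrightarrow>
    word_equiv X R (u @ [(x, b), (x, \<not> b)] @ v) (u @ v)"
| relation: "(s, t) \<in> R \<Longrightarrow> s \<in> words X \<Longrightarrow> t \<in> words X \<Longrightarrow> u \<in> words X \<Longrightarrow> v \<in> words X \<Longrightarrow>
    word_equiv X R (u @ s @ v) (u @ t @ v)"

definition word_class :: "'x set \<Rightarrow> ('x word \<times> 'x word) set \<Rightarrow> 'x word \<Rightarrow> 'x word set" where
  "word_class X R w = {v. word_equiv X R w v}"

definition presented_group :: "'x set \<Rightarrow> ('x word \<times> 'x word) set \<Rightarrow> 'x word set monoid" where
  "presented_group X R =
     \<lparr>carrier = word_class X R ` words X,
      monoid.mult = (\<lambda>a b. \<Union>u\<in>a. \<Union>v\<in>b. word_class X R (u @ v)),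
      one = word_class X R []\<rparr>"

text \<open>\<open>G\<close> admits the presentation \<open>\<langle>X | R\<rangle>\<close>, where \<open>f x\<close> is the element of \<open>G\<close> named by \<open>x\<close>.\<close>
definition has_presentation ::
    "('g, 'm) monoid_scheme \<Rightarrow> ('x \<Rightarrow> 'g) \<Rightarrow> 'x set \<Rightarrow> ('x word \<times> 'x word) set \<Rightarrow> bool" where
  "has_presentation G f X R \<longleftrightarrow>
     (\<exists>\<phi>\<in>iso (presented_group X R) G. \<forall>x\<in>X. \<phi> (word_class X R [(x, True)]) = f x)"

text \<open>\<open>G\<close> is free Abelian on the family \<open>f x\<close>, \<open>x \<in> X\<close> (which is then automatically injective).\<close>
definition free_Abelian_on :: "('g, 'm) monoid_scheme \<Rightarrow> ('x \<Rightarrow> 'g) \<Rightarrow> 'x set \<Rightarrow> bool" where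
  "free_Abelian_on G f X \<longleftrightarrow>
     (\<exists>\<phi>\<in>iso (free_Abelian_group X) G. \<forall>x\<in>X. \<phi> (frag_of x) = f x)"

definition abelianization :: "('g, 'm) monoid_scheme \<Rightarrow> 'g set monoid" where
  "abelianization G = G Mod derived G (carrier G)"

definition abel_proj :: "('g, 'm) monoid_scheme \<Rightarrow> 'g \<Rightarrow> 'g set" where
  "abel_proj G x = derived G (carrier G) #>\<^bsub>G\<^esub> x"


section \<open>The presentations\<close>

text \<open>The names of the generators: \<open>Sig i\<close>, \<open>GenA i\<close>, \<open>GenB i\<close>, \<open>GenZ i\<close> stand for
  \<open>\<sigma>\<^sub>i\<close>, \<open>a\<^sub>i\<close>, \<open>b\<^sub>i\<close>, \<open>\<zeta>\<^sub>i\<close>. In the Abelianization there is a single \<open>\<sigma>\<close>, named \<open>Sig ()\<close>.\<close>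
datatype 's surface_gen = Sig 's | GenA nat | GenB nat | GenZ nat

definition AB_gens :: "nat \<Rightarrow> 's surface_gen set" where
  "AB_gens g = GenA ` {1..g} \<union> GenB ` {1..g}"

definition Z_gens :: "nat \<Rightarrow> 's surface_gen set" where
  "Z_gens n = GenZ ` {1..n}"

definition braid_gens :: "nat \<Rightarrow> nat \<Rightarrow> nat \<Rightarrow> nat surface_gen set" where
  "braid_gens k g n = Sig ` {1..<k} \<union> AB_gens g \<union> Z_gens n"

definition abel_gens :: "nat \<Rightarrow> nat \<Rightarrow> nat \<Rightarrow> unit surface_gen set" where
  "abel_gens k g n = (if k = 1 then {} else {Sig ()}) \<union> AB_gens g \<union> Z_gens n"

abbreviation gen :: "'x \<Rightarrow> 'x word" where
  "gen x \<equiv> [(x, True)]"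

abbreviation gen_inv :: "'x \<Rightarrow> 'x word" where
  "gen_inv x \<equiv> [(x, False)]"

definition commute_rel :: "'x word \<Rightarrow> 'x word \<Rightarrow> 'x word \<times> 'x word" where
  "commute_rel u v = (u @ v, v @ u)"

definition sigma_rels :: "nat \<Rightarrow> (nat surface_gen word \<times> nat surface_gen word) set" where
  "sigma_rels k =
     {commute_rel (gen (Sig i)) (gen (Sig j)) | i j.
        i \<in> {1..<k} \<and> j \<in> {1..<k} \<and> \<bar>int i - int j\<bar> \<ge> 2} \<union>
     {(gen (Sig i) @ gen (Sig (i+1)) @ gen (Sig i), gen (Sig (i+1)) @ gen (Sig i) @ gen (Sig (i+1))) | i.
        i \<in> {1..<k} \<and> i + 1 \<in> {1..<k}}"

definition mixed_rels :: "nat \<Rightarrow> nat \<Rightarrow> nat \<Rightarrow> (nat surface_gen word \<times> nat surface_gen word) set" where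
  "mixed_rels k g n =
     {commute_rel (gen c) (gen (Sig i)) | c i. c \<in> AB_gens g \<union> Z_gens n \<and> i \<in> {1..<k} \<and> i \<noteq> 1}"

text \<open>The relations that involve \<open>\<sigma>\<^sub>1\<close> together with the other generators; they only make sense for \<open>k \<ge> 2\<close>.\<close>
definition sigma1_rels :: "nat \<Rightarrow> nat \<Rightarrow> (nat surface_gen word \<times> nat surface_gen word) set" where
  "sigma1_rels g n =
     (let s = gen (Sig 1); s' = gen_inv (Sig 1) in
     {(gen c @ s @ gen c @ s, s @ gen c @ s @ gen c) | c. c \<in> AB_gens g \<union> Z_gens n} \<union>
     {(gen (GenA i) @ s @ gen (GenB i), s @ gen (GenB i) @ s @ gen (GenA i) @ s) | i. i \<in> {1..g}} \<union>
     {commute_rel (s' @ gen c @ s) (gen d) | c d i j. i \<in> {1..g} \<and> j \<in> {1..g} \<and> i < j \<and>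
        c \<in> {GenA i, GenB i} \<and> d \<in> {GenA j, GenB j}} \<union>
     {commute_rel (s' @ gen (GenZ i) @ s) (gen c) | i c. i \<in> {1..n} \<and> c \<in> AB_gens g} \<union>
     {commute_rel (s' @ gen (GenZ i) @ s) (gen (GenZ j)) | i j.
        i \<in> {1..n} \<and> j \<in> {1..n} \<and> i < j})"

definition braid_rels :: "nat \<Rightarrow> nat \<Rightarrow> nat \<Rightarrow> (nat surface_gen word \<times> nat surface_gen word) set" where
  "braid_rels k g n = sigma_rels k \<union> mixed_rels k g n \<union> (if k = 1 then {} else sigma1_rels g n)"

definition abel_rels :: "nat \<Rightarrow> nat \<Rightarrow> nat \<Rightarrow> (unit surface_gen word \<times> unit surface_gen word) set" where
  "abel_rels k g n =
     {commute_rel (gen x) (gen y) | x y. x \<in> abel_gens k g n \<and> y \<in> abel_gens k g n \<and> x \<noteq> y} \<union>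
     (if g \<ge> 1 \<and> k \<noteq> 1 then {(gen (Sig ()) @ gen (Sig ()), [])} else {})"

abbreviation abel_name :: "'s surface_gen \<Rightarrow> unit surface_gen" where
  "abel_name \<equiv> map_surface_gen (\<lambda>_. ())"

end

theory Submission
  imports Defs
begin

text \<open>Words evaluate in every commutative group, where the surface braid relations collapse: the braid
  relations say that all \<open>\<sigma>\<^sub>i\<close> agree with one element \<open>\<sigma>\<close>, the relation between \<open>a\<^sub>i\<close>, \<open>b\<^sub>i\<close> and
  \<open>\<sigma>\<^sub>1\<close> says that \<open>\<sigma>\<^sup>2 = 1\<close>, and the others hold automatically. Hence the Abelianization is universal
  among the commutative groups with a family of elements indexed by \<open>{\<sigma>} \<union> AB \<union> Z\<close> that satisfies
  \<open>\<sigma>\<^sup>2 = 1\<close> if \<open>g \<ge> 1\<close>. The group given by the claimed presentation, the free Abelian group and its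
  product with \<open>\<int>\<^sub>2\<close> have the same universal property in their respective cases, and homomorphisms that
  are mutually inverse on generators are isomorphisms.\<close>

text \<open>Membership in \<open>words X\<close> has to survive classical reasoning intact, because
  many facts below take it as a premise; this rule would turn it into a statement about single
  letters.\<close>

declare in_listsD [rule del]

section \<open>Presented groups\<close>

definition word_eval :: "('g, 'm) monoid_scheme \<Rightarrow> ('x \<Rightarrow> 'g) \<Rightarrow> 'x word \<Rightarrow> 'g" where
  "word_eval G f w = foldr (\<lambda>(x, b) a. (if b then f x else inv\<^bsub>G\<^esub> f x) \<otimes>\<^bsub>G\<^esub> a) w \<one>\<^bsub>G\<^esub>"

text \<open>Pairs with a side that is not a word over \<open>X\<close> impose nothing, in agreement
  with the premises of \<open>word_equiv.relation\<close>.\<close>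

definition satisfies_rels ::
    "('g, 'm) monoid_scheme \<Rightarrow> ('x \<Rightarrow> 'g) \<Rightarrow> 'x set \<Rightarrow> ('x word \<times> 'x word) set \<Rightarrow> bool" where
  "satisfies_rels G f X R \<longleftrightarrow>
     (\<forall>(s, t)\<in>R. s \<in> words X \<longrightarrow> t \<in> words X \<longrightarrow> word_eval G f s = word_eval G f t)"

lemma word_eval_Nil [simp]: "word_eval G f [] = \<one>\<^bsub>G\<^esub>"
  by (simp add: word_eval_def)

lemma word_eval_Cons [simp]:
  "word_eval G f ((x, b) # w) = (if b then f x else inv\<^bsub>G\<^esub> f x) \<otimes>\<^bsub>G\<^esub> word_eval G f w"
  by (simp add: word_eval_def)

section \<open>Evaluation of words in a group\<close>

context group
begin

lemma word_eval_closed: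
  assumes "f \<in> X \<rightarrow> carrier G" "w \<in> words X"
  shows "word_eval G f w \<in> carrier G"
  using assms(2) by (induction w) (use assms(1)[THEN funcset_mem] in auto)

lemma word_eval_append:
  assumes "f \<in> X \<rightarrow> carrier G" "u \<in> words X" "v \<in> words X"
  shows "word_eval G f (u @ v) = word_eval G f u \<otimes> word_eval G f v"
  using assms(2)
proof (induction u)
  case Nil
  then show ?case using word_eval_closed[OF assms(1,3)] by simp
next
  case (Cons p u)
  obtain x b where p: "p = (x, b)" by fastforce
  show ?case
    using Cons assms(1)[THEN funcset_mem] word_eval_closed[OF assms(1,3)] word_eval_closed[OF assms(1), of u]
    unfolding p by (auto simp: m_assoc)
qed

text \<open>Evaluation is multiplicative, so inside any context a cancelling pair contributes 1 and
  the two sides of a relation contribute the same value.\<close>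

lemma word_eval_equiv:
  assumes f: "f \<in> X \<rightarrow> carrier G" and R: "satisfies_rels G f X R" and e: "word_equiv X R v w"
  shows "word_eval G f v = word_eval G f w"
  using e
proof induction
  case (cancel x u v b)
  then have x: "f x \<in> carrier G" using f by auto
  have v: "word_eval G f v \<in> carrier G" using f cancel(3) by (rule word_eval_closed)
  have "word_eval G f ([(x, b), (x, \<not> b)] @ v) = word_eval G f v"
    using x v by (cases b) (simp_all add: inv_solve_left' flip: m_assoc)
  then show ?case
    using cancel word_eval_append[OF f, of u "[(x, b), (x, \<not> b)] @ v"] word_eval_append[OF f, of u v]
    by simp
next
  case (relation s t u v)
  then have "word_eval G f s = word_eval G f t"
    using R by (auto simp: satisfies_rels_def)
  then show ?case
    using relation by (simp add: word_eval_append[OF f])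
qed simp_all

lemma word_eval_in_generate:
  assumes "f \<in> X \<rightarrow> carrier G" "w \<in> words X"
  shows "word_eval G f w \<in> generate G (f ` X)"
  using assms(2)
proof (induction w)
  case (Cons p w)
  obtain x b where p: "p = (x, b)" by fastforce
  with Cons have "f x \<in> f ` X" by auto
  then show ?case
    using Cons p by (auto intro: generate.eng generate.incl generate.inv)
qed (simp add: generate.one)

end

lemma (in group_hom) hom_word_eval:
  assumes "f \<in> X \<rightarrow> carrier G" "w \<in> words X"
  shows "h (word_eval G f w) = word_eval H (\<lambda>x. h (f x)) w"
  using assms(2)
proof (induction w)
  case (Cons p w)
  obtain x b where p: "p = (x, b)" by fastforce
  show ?case
    using Cons assms(1)[THEN funcset_mem] G.word_eval_closed[OF assms(1), of w] unfolding p by auto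
qed simp

text \<open>Homomorphisms commute with evaluation. This carries relations from a presented group to
  a group isomorphic to it, and on to the Abelianization.\<close>

lemma satisfies_rels_hom:
  assumes "group G" "group H" "h \<in> hom G H" "f \<in> X \<rightarrow> carrier G" "satisfies_rels G f X R"
  shows "satisfies_rels H (\<lambda>x. h (f x)) X R"
proof -
  interpret group_hom G H h
    using assms by (simp add: group_hom_def group_hom_axioms_def)
  show ?thesis
    using assms(5) unfolding satisfies_rels_def
    by (auto simp flip: hom_word_eval[OF assms(4)])
qed

section \<open>The congruence on words\<close>

lemma word_equiv_words:
  assumes "word_equiv X R v w"
  shows "v \<in> words X" "w \<in> words X"
proof -
  have "v \<in> words X \<and> w \<in> words X"
    using assms by induction auto
  then show "v \<in> words X" "w \<in> words X" by simp_all
qed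

text \<open>The rules \<open>cancel\<close> and \<open>relation\<close> already act inside arbitrary
  contexts, so \<open>a\<close> and \<open>b\<close> are absorbed into these.\<close>

lemma word_equiv_context:
  assumes "word_equiv X R v w" "a \<in> words X" "b \<in> words X"
  shows "word_equiv X R (a @ v @ b) (a @ w @ b)"
  using assms(1)
proof induction
  case (cancel x u v c)
  then show ?case
    using word_equiv.cancel[of x X "a @ u" "v @ b" R c] assms(2,3) by simp
next
  case (relation s t u v)
  then show ?case
    using word_equiv.relation[of s t R X "a @ u" "v @ b"] assms(2,3) by simp
next
  case (trans u v w)
  from trans.IH show ?case by (rule word_equiv.trans)
next
  case (refl w)
  then show ?case using assms(2,3) by (intro word_equiv.refl) simp
qed (rule word_equiv.sym)

lemma word_equiv_append:
  assumes "word_equiv X R u u'" "word_equiv X R v v'"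
  shows "word_equiv X R (u @ v) (u' @ v')"
proof (rule word_equiv.trans)
  show "word_equiv X R (u @ v) (u' @ v)"
    using word_equiv_context[OF assms(1), of "[]" v] word_equiv_words[OF assms(2)] by simp
  show "word_equiv X R (u' @ v) (u' @ v')"
    using word_equiv_context[OF assms(2), of u' "[]"] word_equiv_words[OF assms(1)] by simp
qed

lemma word_class_eqI: "word_equiv X R v w \<Longrightarrow> word_class X R v = word_class X R w"
  unfolding word_class_def by (auto intro: word_equiv.sym word_equiv.trans)

lemma word_class_self: "w \<in> words X \<Longrightarrow> w \<in> word_class X R w"
  by (simp add: word_class_def word_equiv.refl)

section \<open>The group of word classes\<close>

lemma carrier_presented_group: "carrier (presented_group X R) = word_class X R ` words X"
  and one_presented_group: "\<one>\<^bsub>presented_group X R\<^esub> = word_class X R []"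
  by (simp_all add: presented_group_def)

text \<open>The product is a union over all representatives; by the congruence property all sets in
  this union coincide.\<close>

lemma mult_presented_group:
  assumes "u \<in> words X" "v \<in> words X"
  shows "word_class X R u \<otimes>\<^bsub>presented_group X R\<^esub> word_class X R v = word_class X R (u @ v)"
proof -
  have eq: "word_class X R (u' @ v') = word_class X R (u @ v)"
    if "u' \<in> word_class X R u" "v' \<in> word_class X R v" for u' v'
    using that unfolding word_class_def[of X R u] word_class_def[of X R v]
    by (auto intro!: word_class_eqI word_equiv_append intro: word_equiv.sym)
  show ?thesis
    using eq word_class_self[OF assms(1), of R] word_class_self[OF assms(2), of R]
    unfolding presented_group_def monoid.simps by blast
qed

text \<open>The left inverse is the reversed word with all exponents flipped; cancellation proceeds
  from the middle outwards.\<close>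

lemma word_equiv_inverse:
  assumes "w \<in> words X"
  shows "word_equiv X R (rev (map (\<lambda>(x, b). (x, \<not> b)) w) @ w) []"
  using assms
proof (induction w)
  case Nil
  then show ?case by (simp add: word_equiv.refl)
next
  case (Cons p w)
  obtain x b where p: "p = (x, b)" by fastforce
  let ?i = "rev (map (\<lambda>(x, b). (x, \<not> b)) w)"
  have "?i \<in> words X" using Cons by (auto simp: in_lists_conv_set)
  \<comment> \<open>The double negation gives the pair the shape of \<open>cancel\<close> at
    exponent \<open>\<not> b\<close>.\<close>
  then have "word_equiv X R (?i @ [(x, \<not> b), (x, \<not> \<not> b)] @ w) (?i @ w)"
    using Cons p by (intro word_equiv.cancel) auto
  then show ?case
    using Cons p by (auto intro: word_equiv.trans)
qed

lemma group_presented_group: "group (presented_group X R)"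
proof (rule groupI)
  fix a assume "a \<in> carrier (presented_group X R)"
  then obtain w where w: "w \<in> words X" "a = word_class X R w"
    by (auto simp: carrier_presented_group)
  let ?i = "rev (map (\<lambda>(x, b). (x, \<not> b)) w)"
  have i: "?i \<in> words X" using w by (auto simp: in_lists_conv_set)
  then have "word_class X R ?i \<otimes>\<^bsub>presented_group X R\<^esub> a = \<one>\<^bsub>presented_group X R\<^esub>"
    unfolding w(2) mult_presented_group[OF i w(1)] one_presented_group
    by (intro word_class_eqI word_equiv_inverse w)
  with i show "\<exists>b\<in>carrier (presented_group X R). b \<otimes>\<^bsub>presented_group X R\<^esub> a = \<one>\<^bsub>presented_group X R\<^esub>"
    unfolding carrier_presented_group by blast
qed (auto simp: carrier_presented_group one_presented_group mult_presented_group)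

abbreviation gen_class :: "'x set \<Rightarrow> ('x word \<times> 'x word) set \<Rightarrow> 'x \<Rightarrow> 'x word set" where
  "gen_class X R x \<equiv> word_class X R [(x, True)]"

lemma gen_class_closed: "gen_class X R \<in> X \<rightarrow> carrier (presented_group X R)"
  by (auto simp: carrier_presented_group)

text \<open>An inverse letter represents the inverse class, so evaluation at the generator classes
  is the quotient map from words to classes.\<close>

lemma word_eval_gen_class:
  assumes "w \<in> words X"
  shows "word_eval (presented_group X R) (gen_class X R) w = word_class X R w"
  using assms
proof (induction w)
  case (Cons p w)
  interpret P: group "presented_group X R" by (rule group_presented_group)
  obtain x b where p: "p = (x, b)" by fastforce
  with Cons have x: "x \<in> X" by auto
  have "word_class X R [(x, False)] \<otimes>\<^bsub>presented_group X R\<^esub> gen_class X R x = \<one>\<^bsub>presented_group X R\<^esub>"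
    using x word_equiv.cancel[of x X "[]" "[]" R False]
    by (simp add: mult_presented_group one_presented_group word_class_eqI)
  then have "inv\<^bsub>presented_group X R\<^esub> (gen_class X R x) = word_class X R [(x, False)]"
    using x by (intro P.inv_equality) (auto simp: carrier_presented_group)
  then have "word_eval (presented_group X R) (gen_class X R) (p # w)
      = word_class X R [(x, b)] \<otimes>\<^bsub>presented_group X R\<^esub> word_class X R w"
    using Cons by (cases b) (auto simp: p)
  also have "\<dots> = word_class X R (p # w)"
    using Cons x p by (subst mult_presented_group) auto
  finally show ?case .
qed (simp add: one_presented_group)

lemma satisfies_rels_presented_group:
  "satisfies_rels (presented_group X R) (gen_class X R) X R"
  unfolding satisfies_rels_def
proof (intro ballI, clarify)
  fix s t assume "(s, t) \<in> R" and w: "s \<in> words X" "t \<in> words X"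
  then have "word_equiv X R s t"
    using word_equiv.relation[of s t R X "[]" "[]"] by simp
  then show "word_eval (presented_group X R) (gen_class X R) s =
      word_eval (presented_group X R) (gen_class X R) t"
    by (simp add: word_eval_gen_class w word_class_eqI)
qed

lemma generate_presented_group:
  "generate (presented_group X R) (gen_class X R ` X) = carrier (presented_group X R)"
proof
  interpret group "presented_group X R" by (rule group_presented_group)
  show "generate (presented_group X R) (gen_class X R ` X) \<subseteq> carrier (presented_group X R)"
    by (rule generate_incl) (rule funcset_image[OF gen_class_closed])
  show "carrier (presented_group X R) \<subseteq> generate (presented_group X R) (gen_class X R ` X)"
    unfolding carrier_presented_group
  proof (rule image_subsetI)
    fix w assume "w \<in> words X"
    then show "word_class X R w \<in> generate (presented_group X R) (gen_class X R ` X)"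
      using word_eval_in_generate[OF gen_class_closed] by (metis word_eval_gen_class)
  qed
qed

text \<open>Von Dyck's theorem: evaluation descends to word classes.\<close>

lemma (in group) presented_group_universal:
  assumes f: "f \<in> X \<rightarrow> carrier G" and R: "satisfies_rels G f X R"
  obtains h where "h \<in> hom (presented_group X R) G" "\<And>x. x \<in> X \<Longrightarrow> h (gen_class X R x) = f x"
proof
  \<comment> \<open>The argument is meant to be a word class; \<open>word_eval_equiv\<close> makes
    the value independent of the chosen representative.\<close>
  define h where "h a = word_eval G f (SOME w. w \<in> a)" for a
  have h: "h (word_class X R w) = word_eval G f w" if "w \<in> words X" for w
  proof -
    have "(SOME v. v \<in> word_class X R w) \<in> word_class X R w"
      using word_class_self[OF that] by (rule someI)
    then have "word_equiv X R w (SOME v. v \<in> word_class X R w)"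
      by (subst (asm) word_class_def) simp
    from word_eval_equiv[OF f R this] show ?thesis by (simp add: h_def)
  qed
  show "h \<in> hom (presented_group X R) G"
    unfolding hom_def carrier_presented_group
    by (auto simp: mult_presented_group h word_eval_append[OF f] word_eval_closed[OF f])
  show "h (gen_class X R x) = f x" if "x \<in> X" for x
    using that f[THEN funcset_mem] by (simp add: h)
qed

section \<open>Homomorphisms and generating families\<close>

lemma hom_eq_on_generate:
  assumes "group G" "group H" "h \<in> hom G H" "h' \<in> hom G H" "S \<subseteq> carrier G"
    and eq: "\<And>s. s \<in> S \<Longrightarrow> h s = h' s" and a: "a \<in> generate G S"
  shows "h a = h' a"
proof -
  interpret h: group_hom G H h
    using assms by (simp add: group_hom_def group_hom_axioms_def)
  interpret h': group_hom G H h'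
    using assms by (simp add: group_hom_def group_hom_axioms_def)
  show ?thesis
    using a
  proof induction
    case (inv s)
    then show ?case using assms(5) eq by auto
  next
    case (eng a b)
    then show ?case using h.G.generate_in_carrier[OF assms(5)] by simp
  qed (simp_all add: eq)
qed

text \<open>Both composites fix a generating family and are therefore the identity. The two families
  share the index set \<open>S\<close> and may repeat elements.\<close>

lemma iso_by_generators:
  assumes G: "group G" and H: "group H"
    and f: "f \<in> S \<rightarrow> carrier G" "generate G (f ` S) = carrier G"
    and f': "f' \<in> S \<rightarrow> carrier H" "generate H (f' ` S) = carrier H"
    and h: "h \<in> hom G H" "\<And>s. s \<in> S \<Longrightarrow> h (f s) = f' s"
    and k: "k \<in> hom H G" "\<And>s. s \<in> S \<Longrightarrow> k (f' s) = f s"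
  shows "h \<in> iso G H"
proof (rule isoI)
  have "(k \<circ> h) a = id a" if "a \<in> carrier G" for a
  proof (rule hom_eq_on_generate[OF G G, where h = "k \<circ> h" and h' = id and S = "f ` S"])
    show "k \<circ> h \<in> hom G G" using h(1) k(1) by (rule hom_compose)
    show "id \<in> hom G G" by (simp add: hom_def Pi_def)
    show "a \<in> generate G (f ` S)" using that f(2) by simp
  qed (use f(1) h(2) k(2) in auto)
  moreover have "(h \<circ> k) a = id a" if "a \<in> carrier H" for a
  proof (rule hom_eq_on_generate[OF H H, where h = "h \<circ> k" and h' = id and S = "f' ` S"])
    show "h \<circ> k \<in> hom H H" using k(1) h(1) by (rule hom_compose)
    show "id \<in> hom H H" by (simp add: hom_def Pi_def)
    show "a \<in> generate H (f' ` S)" using that f'(2) by simp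
  qed (use f'(1) h(2) k(2) in auto)
  ultimately show "bij_betw h (carrier G) (carrier H)"
    using h(1) k(1) by (intro bij_betwI[where g = k]) (simp_all add: hom_carrier hom_in_carrier)
qed (rule h(1))

section \<open>Groups with a given presentation\<close>

context
  fixes G :: "('g, 'm) monoid_scheme" and f :: "'x \<Rightarrow> 'g" and X R
  assumes G: "group G" and pres: "has_presentation G f X R"
begin

lemma has_presentation_closed: "f \<in> X \<rightarrow> carrier G"
  and has_presentation_generate: "generate G (f ` X) = carrier G"
  and has_presentation_satisfies: "satisfies_rels G f X R"
proof -
  obtain \<phi> where \<phi>: "\<phi> \<in> iso (presented_group X R) G" and eq: "\<And>x. x \<in> X \<Longrightarrow> \<phi> (gen_class X R x) = f x"
    using pres unfolding has_presentation_def by blast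
  interpret \<phi>: group_hom "presented_group X R" G \<phi>
    using \<phi> G group_presented_group
    by (simp add: group_hom_def group_hom_axioms_def iso_def)
  show "f \<in> X \<rightarrow> carrier G"
    using gen_class_closed[of X R] by (auto simp flip: eq intro!: \<phi>.hom_closed)
  have img: "f ` X = \<phi> ` gen_class X R ` X"
    by (auto simp: eq image_iff)
  have "gen_class X R ` X \<subseteq> carrier (presented_group X R)"
    by (rule funcset_image[OF gen_class_closed])
  from \<phi>.generate_img[OF this] show "generate G (f ` X) = carrier G"
    unfolding img generate_presented_group using \<phi> by (simp add: iso_def bij_betw_def)
  \<comment> \<open>The two assignments are known to agree on \<open>X\<close>, which is enough for
    words over \<open>X\<close>.\<close>
  have ev: "word_eval G (\<lambda>x. \<phi> (gen_class X R x)) w = word_eval G f w" if "w \<in> words X" for w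
    using that by (induction w) (auto simp: eq)
  show "satisfies_rels G f X R"
    using satisfies_rels_hom[OF group_presented_group G \<phi>.homh gen_class_closed satisfies_rels_presented_group]
    by (auto simp: satisfies_rels_def ev)
qed

text \<open>Von Dyck's theorem, transported along the inverse of the presenting isomorphism.\<close>

lemma has_presentation_universal:
  assumes "group H" "f' \<in> X \<rightarrow> carrier H" "satisfies_rels H f' X R"
  obtains h where "h \<in> hom G H" "\<And>x. x \<in> X \<Longrightarrow> h (f x) = f' x"
proof -
  obtain \<phi> where \<phi>: "\<phi> \<in> iso (presented_group X R) G" and eq: "\<And>x. x \<in> X \<Longrightarrow> \<phi> (gen_class X R x) = f x"
    using pres unfolding has_presentation_def by blast
  obtain h where h: "h \<in> hom (presented_group X R) H" "\<And>x. x \<in> X \<Longrightarrow> h (gen_class X R x) = f' x"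
    using group.presented_group_universal[OF assms] by blast
  let ?\<psi> = "inv_into (carrier (presented_group X R)) \<phi>"
  have "?\<psi> \<in> iso G (presented_group X R)"
    using group_presented_group \<phi> by (rule group.iso_set_sym)
  then have hom: "h \<circ> ?\<psi> \<in> hom G H"
    using h(1) by (intro hom_compose) (simp_all add: iso_def)
  have "(h \<circ> ?\<psi>) (f x) = f' x" if "x \<in> X" for x
  proof -
    have "gen_class X R x \<in> carrier (presented_group X R)"
      using that by (rule funcset_mem[OF gen_class_closed])
    moreover have "inj_on \<phi> (carrier (presented_group X R))"
      using \<phi> by (simp add: iso_def bij_betw_def)
    ultimately have "?\<psi> (f x) = gen_class X R x"
      using eq[OF that] by (metis inv_into_f_f)
    then show ?thesis using h(2)[OF that] by simp
  qed
  with hom show ?thesis by (intro that[of "h \<circ> ?\<psi>"]) simp_all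
qed

end

section \<open>Abelianization\<close>

lemma comm_group_abelianization: "group G \<Longrightarrow> comm_group (abelianization G)"
  unfolding abelianization_def by (rule group.derived_quot_is_comm_group)

lemma group_abelianization: "group G \<Longrightarrow> group (abelianization G)"
  by (rule comm_group.axioms(2)[OF comm_group_abelianization])

lemma group_hom_abel_proj:
  assumes "group G"
  shows "group_hom G (abelianization G) (abel_proj G)"
proof -
  have "(\<lambda>a. derived G (carrier G) #>\<^bsub>G\<^esub> a) \<in> hom G (G Mod derived G (carrier G))"
    by (intro normal.r_coset_hom_Mod group.derived_self_is_normal assms)
  then show ?thesis
    using assms group_abelianization[OF assms]
    by (simp add: group_hom_def group_hom_axioms_def abelianization_def abel_proj_def[abs_def])
qed

text \<open>The image of the derived subgroup is the derived subgroup of the image, which is trivial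
  in a commutative group; so \<open>h\<close> factors through the quotient.\<close>

lemma abelianization_universal:
  assumes G: "group G" and H: "comm_group H" and h: "h \<in> hom G H"
  obtains h' where "h' \<in> hom (abelianization G) H" "\<And>a. a \<in> carrier G \<Longrightarrow> h' (abel_proj G a) = h a"
proof -
  interpret H: comm_group H by (rule H)
  interpret group_hom G H h
    using G H h by (simp add: group_hom_def group_hom_axioms_def comm_group_def)
  have "h ` derived G (carrier G) = {\<one>\<^bsub>H\<^esub>}"
    by (subst derived_img[symmetric]) (auto intro!: H.derived_eq_singleton)
  then have "derived G (carrier G) \<subseteq> kernel G H h"
    using derived_in_carrier[of "carrier G"] by (auto simp: kernel_def)
  from FactGroup_universal_kernel[OF derived_self_is_normal this] that show ?thesis
    unfolding abelianization_def abel_proj_def by blast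
qed

lemma generate_abelianization:
  assumes G: "group G" and S: "S \<subseteq> carrier G" "generate G S = carrier G"
  shows "generate (abelianization G) (abel_proj G ` S) = carrier (abelianization G)"
proof -
  interpret group_hom G "abelianization G" "abel_proj G"
    by (rule group_hom_abel_proj[OF G])
  show ?thesis
    unfolding generate_img[OF S(1)] S(2)
    by (auto simp: abelianization_def abel_proj_def carrier_FactGroup)
qed

text \<open>The auxiliary claim is used twice: first with a generator as \<open>b\<close>, which
  shows that generators are central, then with an arbitrary \<open>b\<close>, which by the first use
  commutes with every generator.\<close>

lemma comm_group_if_generators_commute:
  fixes G (structure)
  assumes "group G" and S: "S \<subseteq> carrier G" "generate G S = carrier G"
    and comm: "\<And>x y. x \<in> S \<Longrightarrow> y \<in> S \<Longrightarrow> x \<otimes> y = y \<otimes> x"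
  shows "comm_group G"
proof -
  interpret group G by fact
  have *: "b \<otimes> a = a \<otimes> b"
    if "a \<in> generate G S" and b: "b \<in> carrier G" "\<And>s. s \<in> S \<Longrightarrow> b \<otimes> s = s \<otimes> b" for a b
    using that(1)
  proof induction
    case one
    then show ?case using b(1) by simp
  next
    case (incl s)
    then show ?case by (rule b(2))
  next
    case (inv s)
    then have s: "s \<in> carrier G" using S(1) by blast
    \<comment> \<open>Multiplying \<open>b \<otimes> s = s \<otimes> b\<close> by
      \<open>inv s\<close> on both sides moves the commutation to the inverse.\<close>
    have "inv s \<otimes> (b \<otimes> s) \<otimes> inv s = inv s \<otimes> (s \<otimes> b) \<otimes> inv s"
      by (simp only: b(2)[OF inv])
    then show ?case using s b(1) by (simp add: m_assoc inv_solve_left)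
  next
    case (eng a c)
    then have "a \<in> carrier G" "c \<in> carrier G" using S(2) by auto
    then have "b \<otimes> (a \<otimes> c) = a \<otimes> b \<otimes> c" "a \<otimes> c \<otimes> b = a \<otimes> (b \<otimes> c)"
      using eng.IH b(1) by (simp_all flip: m_assoc)
    then show ?case
      using \<open>a \<in> carrier G\<close> \<open>c \<in> carrier G\<close> b(1) by (simp add: m_assoc)
  qed
  show ?thesis
  proof (rule group_comm_groupI)
    fix a b assume ab: "a \<in> carrier G" "b \<in> carrier G"
    have "b \<otimes> s = s \<otimes> b" if "s \<in> S" for s
    proof (rule *[symmetric])
      show "b \<in> generate G S" using ab(2) S(2) by simp
      show "s \<in> carrier G" using that S(1) by blast
      show "s \<otimes> s' = s' \<otimes> s" if "s' \<in> S" for s'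
        using \<open>s \<in> S\<close> that by (rule comm)
    qed
    then show "a \<otimes> b = b \<otimes> a"
      using ab S(2) *[of a b] by simp
  qed
qed

text \<open>This composes the factorizations through the presentation and through the quotient: to
  map out of the Abelianization it suffices to check the relations of \<open>G\<close> in a
  commutative target.\<close>

lemma abelianization_presentation_universal:
  assumes G: "group G" "has_presentation G f X R"
    and H: "comm_group H" "f' \<in> X \<rightarrow> carrier H" "satisfies_rels H f' X R"
  obtains h where "h \<in> hom (abelianization G) H" "\<And>x. x \<in> X \<Longrightarrow> h (abel_proj G (f x)) = f' x"
proof -
  obtain h where h: "h \<in> hom G H" "\<And>x. x \<in> X \<Longrightarrow> h (f x) = f' x"
    using has_presentation_universal[OF G comm_group.axioms(2)[OF H(1)] H(2,3)] by blast
  obtain h' where h': "h' \<in> hom (abelianization G) H" "\<And>a. a \<in> carrier G \<Longrightarrow> h' (abel_proj G a) = h a"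
    using abelianization_universal[OF G(1) H(1) h(1)] by blast
  show ?thesis
    using h' h(2) funcset_mem[OF has_presentation_closed[OF G]] by (intro that[of h']) simp_all
qed

section \<open>The relations in commutative groups\<close>

context comm_group
begin

text \<open>Arbitrary words \<open>u\<close> and \<open>v\<close> are allowed, so that commutation
  with conjugates such as \<open>s' @ gen c @ s\<close> is covered. The equation with
  \<open>(s, t)\<close> fits a pair drawn from a set of relations.\<close>

lemma word_eval_commute_rel:
  assumes "f \<in> X \<rightarrow> carrier G" "commute_rel u v = (s, t)" "s \<in> words X"
  shows "word_eval G f s = word_eval G f t"
proof -
  have st: "s = u @ v" "t = v @ u" and "u \<in> words X" "v \<in> words X"
    using assms(2,3) by (simp_all add: commute_rel_def split: prod.splits) (metis append_in_lists_conv)+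
  then show ?thesis
    using word_eval_closed[OF assms(1)] by (simp add: word_eval_append[OF assms(1)] m_comm)
qed

text \<open>All relations except the square of \<sigma> are commutations, so only that square
  remains as a condition.\<close>

lemma satisfies_abel_rels_iff:
  assumes f: "f \<in> abel_gens k g n \<rightarrow> carrier G"
  shows "satisfies_rels G f (abel_gens k g n) (abel_rels k g n) \<longleftrightarrow>
    (g \<ge> 1 \<and> k \<noteq> 1 \<longrightarrow> f (Sig ()) \<otimes> f (Sig ()) = \<one>)"
proof
  assume sat: "satisfies_rels G f (abel_gens k g n) (abel_rels k g n)"
  show "g \<ge> 1 \<and> k \<noteq> 1 \<longrightarrow> f (Sig ()) \<otimes> f (Sig ()) = \<one>"
  proof
    assume gk: "g \<ge> 1 \<and> k \<noteq> 1"
    then have s: "Sig () \<in> abel_gens k g n" by (simp add: abel_gens_def)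
    have "(gen (Sig ()) @ gen (Sig ()), []) \<in> abel_rels k g n"
      using gk by (simp add: abel_rels_def)
    then have "word_eval G f (gen (Sig ()) @ gen (Sig ())) = word_eval G f []"
      using sat s by (fastforce simp: satisfies_rels_def)
    then show "f (Sig ()) \<otimes> f (Sig ()) = \<one>"
      using funcset_mem[OF f s] by simp
  qed
next
  assume s: "g \<ge> 1 \<and> k \<noteq> 1 \<longrightarrow> f (Sig ()) \<otimes> f (Sig ()) = \<one>"
  have "word_eval G f u = word_eval G f v"
    if "(u, v) \<in> abel_rels k g n" and w: "u \<in> words (abel_gens k g n)" for u v
    using that(1) unfolding abel_rels_def
  proof (elim UnE)
    assume "(u, v) \<in> {commute_rel (gen x) (gen y) | x y.
      x \<in> abel_gens k g n \<and> y \<in> abel_gens k g n \<and> x \<noteq> y}"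
    then obtain x y where "commute_rel (gen x) (gen y) = (u, v)" by auto
    then show ?thesis
      using w by (rule word_eval_commute_rel[OF f])
  next
    assume "(u, v) \<in> (if g \<ge> 1 \<and> k \<noteq> 1 then {(gen (Sig ()) @ gen (Sig ()), [])} else {})"
    then show ?thesis
      using s w funcset_mem[OF f, of "Sig ()"] by (auto split: if_splits)
  qed
  then show "satisfies_rels G f (abel_gens k g n) (abel_rels k g n)"
    by (auto simp: satisfies_rels_def)
qed

text \<open>After reordering, the braid relations cancel to equality of neighbouring generators and
  the relation \<open>a s b = s b s a s\<close> cancels to \<open>s s = 1\<close>; all others hold
  identically. For \<open>k = 1\<close>, where \<open>Sig 1\<close> is not a generator, both
  conditions are vacuous.\<close>

lemma satisfies_braid_rels_iff:
  assumes f: "f \<in> braid_gens k g n \<rightarrow> carrier G" and k: "k \<ge> 1"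
  shows "satisfies_rels G f (braid_gens k g n) (braid_rels k g n) \<longleftrightarrow>
    (\<forall>i\<in>{1..<k}. f (Sig i) = f (Sig 1)) \<and> (g \<ge> 1 \<and> k \<noteq> 1 \<longrightarrow> f (Sig 1) \<otimes> f (Sig 1) = \<one>)"
    (is "?sat \<longleftrightarrow> ?eq \<and> ?sq")
proof (intro iffI conjI)
  assume sat: ?sat
  have Sig: "Sig i \<in> braid_gens k g n" if "1 \<le> i" "i < k" for i
    using that by (simp add: braid_gens_def)
  have step: "f (Sig (i + 1)) = f (Sig i)" if i: "1 \<le> i" "i + 1 < k" for i
  proof -
    have c: "f (Sig i) \<in> carrier G" "f (Sig (i + 1)) \<in> carrier G"
      using Sig[of i] Sig[of "i + 1"] i f by auto
    have "(gen (Sig i) @ gen (Sig (i+1)) @ gen (Sig i), gen (Sig (i+1)) @ gen (Sig i) @ gen (Sig (i+1)))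
        \<in> braid_rels k g n"
      using i unfolding braid_rels_def sigma_rels_def by auto
    then have "word_eval G f (gen (Sig i) @ gen (Sig (i+1)) @ gen (Sig i)) =
        word_eval G f (gen (Sig (i+1)) @ gen (Sig i) @ gen (Sig (i+1)))"
      using sat Sig[of i] Sig[of "i + 1"] i by (fastforce simp: satisfies_rels_def)
    \<comment> \<open>Both sides are ordered so that the product of the two neighbours cancels on
      the left.\<close>
    then have "(f (Sig i) \<otimes> f (Sig (i + 1))) \<otimes> f (Sig i) = (f (Sig i) \<otimes> f (Sig (i + 1))) \<otimes> f (Sig (i + 1))"
      using c by (simp add: m_ac)
    then show ?thesis using c by (metis Units_eq Units_l_cancel m_closed)
  qed
  have "f (Sig i) = f (Sig 1)" if "1 \<le> i" "i < k" for i
    using that by (induction i rule: nat_induct_at_least) (use step in auto)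
  then show ?eq unfolding Ball_def atLeastLessThan_iff by blast
  show ?sq
  proof
    assume gk: "g \<ge> 1 \<and> k \<noteq> 1"
    \<comment> \<open>One handle suffices, and the first exists because
      \<open>g \<ge> 1\<close>.\<close>
    let ?a = "f (GenA 1)" and ?b = "f (GenB 1)" and ?s = "f (Sig 1)"
    have gens: "Sig 1 \<in> braid_gens k g n" "GenA 1 \<in> braid_gens k g n" "GenB 1 \<in> braid_gens k g n"
      using gk k by (auto simp: braid_gens_def AB_gens_def)
    then have c: "?s \<in> carrier G" "?a \<in> carrier G" "?b \<in> carrier G"
      using f by auto
    let ?l = "gen (GenA 1) @ gen (Sig 1) @ gen (GenB 1)"
    let ?r = "gen (Sig 1) @ gen (GenB 1) @ gen (Sig 1) @ gen (GenA 1) @ gen (Sig 1)"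
    have "(?l, ?r) \<in> sigma1_rels g n"
      using gk unfolding sigma1_rels_def Let_def by auto
    then have "(?l, ?r) \<in> braid_rels k g n"
      using gk by (simp add: braid_rels_def)
    then have "word_eval G f ?l = word_eval G f ?r"
      using sat gens by (fastforce simp: satisfies_rels_def)
    \<comment> \<open>The factor \<open>\<one>\<close> is appended so that left cancellation leaves
      the square alone.\<close>
    then have "(?a \<otimes> ?s \<otimes> ?b) \<otimes> \<one> = (?a \<otimes> ?s \<otimes> ?b) \<otimes> (?s \<otimes> ?s)"
      using c by (simp add: m_ac)
    then show "?s \<otimes> ?s = \<one>" using c by (metis Units_eq Units_l_cancel m_closed one_closed)
  qed
next
  assume eq: "?eq \<and> ?sq"
  let ?X = "braid_gens k g n"
  note comm = word_eval_commute_rel[OF f _]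
  have "word_eval G f u = word_eval G f v" if "(u, v) \<in> braid_rels k g n" and w: "u \<in> words ?X" for u v
    using that(1) unfolding braid_rels_def
  proof (elim UnE)
    assume "(u, v) \<in> sigma_rels k"
    then consider (commute) x y where "commute_rel x y = (u, v)"
      | (braid) i where "i \<in> {1..<k}" "i + 1 \<in> {1..<k}"
          "u = gen (Sig i) @ gen (Sig (i+1)) @ gen (Sig i)"
          "v = gen (Sig (i+1)) @ gen (Sig i) @ gen (Sig (i+1))"
      unfolding sigma_rels_def by auto
    then show ?thesis
    proof cases
      case commute
      then show ?thesis using w by (rule comm)
    next
      case braid
      then have "f (Sig i) = f (Sig 1)" "f (Sig (i+1)) = f (Sig 1)" using eq by blast+
      then show ?thesis unfolding braid by simp
    qed
  next
    assume "(u, v) \<in> mixed_rels k g n"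
    then obtain x y where "commute_rel x y = (u, v)" unfolding mixed_rels_def by auto
    then show ?thesis using w by (rule comm)
  next
    assume "(u, v) \<in> (if k = 1 then {} else sigma1_rels g n)"
    then have "(u, v) \<in> sigma1_rels g n" and k1: "k \<noteq> 1" by (simp_all split: if_splits)
    \<comment> \<open>The three families in \<open>sigma1_rels\<close> that involve conjugates by
      \<sigma> are all built with \<open>commute_rel\<close> and share one case.\<close>
    then consider (commute) x y where "(u, v) = commute_rel x y"
      | (twist) c where "u = gen c @ gen (Sig 1) @ gen c @ gen (Sig 1)"
          "v = gen (Sig 1) @ gen c @ gen (Sig 1) @ gen c"
      | (handle) i where "i \<in> {1..g}" "u = gen (GenA i) @ gen (Sig 1) @ gen (GenB i)"
          "v = gen (Sig 1) @ gen (GenB i) @ gen (Sig 1) @ gen (GenA i) @ gen (Sig 1)"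
      unfolding sigma1_rels_def Let_def by (elim UnE) blast+
    then show ?thesis
    proof cases
      case commute
      from this[symmetric] w show ?thesis by (rule comm)
    next
      case twist
      then have "f c \<in> carrier G" "f (Sig 1) \<in> carrier G" using w f by auto
      then show ?thesis unfolding twist by (simp add: m_ac)
    next
      case handle
      let ?a = "f (GenA i)" and ?b = "f (GenB i)" and ?s = "f (Sig 1)"
      have c: "?s \<in> carrier G" "?a \<in> carrier G" "?b \<in> carrier G"
        using w f unfolding handle by auto
      \<comment> \<open>The existence of a handle index forces \<open>g \<ge> 1\<close>, which makes
        the square condition available.\<close>
      have "?s \<otimes> ?s = \<one>" using eq handle(1) k1 by auto
      moreover have "word_eval G f v = (?a \<otimes> ?s \<otimes> ?b) \<otimes> (?s \<otimes> ?s)"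
        "word_eval G f u = ?a \<otimes> ?s \<otimes> ?b"
        unfolding handle using c by (simp_all add: m_ac)
      ultimately show ?thesis using c by simp
    qed
  qed
  then show ?sat by (auto simp: satisfies_rels_def)
qed

end

text \<open>Commutation is imposed on distinct generators and trivial for equal ones; it then
  spreads to the generated group.\<close>

lemma comm_group_presented_abel:
  "comm_group (presented_group (abel_gens k g n) (abel_rels k g n))" (is "comm_group (presented_group ?Y ?R)")
proof (rule comm_group_if_generators_commute[OF group_presented_group _ generate_presented_group])
  show "gen_class ?Y ?R ` ?Y \<subseteq> carrier (presented_group ?Y ?R)"
    by (rule funcset_image[OF gen_class_closed])
  fix a b assume "a \<in> gen_class ?Y ?R ` ?Y" "b \<in> gen_class ?Y ?R ` ?Y"
  then obtain x y where xy: "x \<in> ?Y" "y \<in> ?Y" "a = gen_class ?Y ?R x" "b = gen_class ?Y ?R y"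
    by blast
  have "word_equiv ?Y ?R (gen x @ gen y) (gen y @ gen x)"
  proof (cases "x = y")
    case True
    then show ?thesis using xy by (auto intro: word_equiv.refl)
  next
    case False
    then have "(gen x @ gen y, gen y @ gen x) \<in> ?R"
      using xy unfolding abel_rels_def commute_rel_def by blast
    from word_equiv.relation[OF this, of ?Y "[]" "[]"] xy show ?thesis by simp
  qed
  then show "a \<otimes>\<^bsub>presented_group ?Y ?R\<^esub> b = b \<otimes>\<^bsub>presented_group ?Y ?R\<^esub> a"
    using xy by (simp add: mult_presented_group word_class_eqI)
qed

section \<open>Free Abelian groups of finite rank\<close>

text \<open>Over a finite index set every family has finite support, so the identity is an
  isomorphism.\<close>

lemma sum_group_finite_iso:
  assumes "finite I" "\<And>i. i \<in> I \<Longrightarrow> group (G i)"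
  shows "sum_group I G \<cong> product_group I G"
proof -
  have "id \<in> iso (sum_group I G) (product_group I G)"
    using assms by (intro isoI homI) (auto simp: carrier_sum_group bij_betw_def)
  then show ?thesis by (auto simp: is_iso_def)
qed

lemma free_Abelian_group_finite_iso:
  assumes "finite S"
  shows "free_Abelian_group S \<cong> product_group {..<card S} (\<lambda>_. integer_group)"
proof -
  have "free_Abelian_group S \<cong> free_Abelian_group {..<card S}"
    unfolding isomorphic_free_Abelian_groups using assms by (simp add: eqpoll_iff_card)
  also have "\<dots> \<cong> sum_group {..<card S} (\<lambda>_. integer_group)"
    by (rule group.iso_sym[OF _ isomorphic_sum_integer_group]) simp
  also have "\<dots> \<cong> product_group {..<card S} (\<lambda>_. integer_group)"
    by (rule sum_group_finite_iso) simp_all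
  finally show ?thesis .
qed

text \<open>Induction over a free Abelian group proceeds by differences, and a subgroup is closed
  under these.\<close>

lemma generate_free_Abelian_group:
  "generate (free_Abelian_group S) (frag_of ` S) = carrier (free_Abelian_group S)" (is "generate ?F _ = _")
proof
  interpret F: group ?F by simp
  show "generate ?F (frag_of ` S) \<subseteq> carrier ?F"
    by (rule F.generate_incl) auto
  interpret K: subgroup "generate ?F (frag_of ` S)" ?F
    by (rule F.generate_is_subgroup) auto
  show "carrier ?F \<subseteq> generate ?F (frag_of ` S)"
  proof
    fix c assume "c \<in> carrier ?F"
    then have "Poly_Mapping.keys c \<subseteq> S" by simp
    then show "c \<in> generate ?F (frag_of ` S)"
    proof (rule free_Abelian_group_induct[where P = "\<lambda>c. c \<in> generate ?F (frag_of ` S)"])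
      show "0 \<in> generate ?F (frag_of ` S)" using K.one_closed by simp
    next
      fix x y assume xy: "Poly_Mapping.keys x \<subseteq> S" "Poly_Mapping.keys y \<subseteq> S"
        "x \<in> generate ?F (frag_of ` S)" "y \<in> generate ?F (frag_of ` S)"
      then have "x \<otimes>\<^bsub>?F\<^esub> inv\<^bsub>?F\<^esub> y \<in> generate ?F (frag_of ` S)"
        by (intro K.m_closed K.m_inv_closed)
      then show "x - y \<in> generate ?F (frag_of ` S)" using xy by simp
    qed (auto intro: generate.incl)
  qed
qed

text \<open>An element \<open>(c, m)\<close> splits as \<open>(c, 0)\<close> times
  \<open>(0, m)\<close>: the first factor lies in the image of the free group under the inclusion,
  the second is the unit or \<open>(0, 1)\<close>.\<close>

lemma generate_free_Abelian_group_times_Z2: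
  fixes S :: "'x set"
  defines "T \<equiv> free_Abelian_group S \<times>\<times> integer_mod_group 2"
  assumes B: "(\<lambda>x. (frag_of x, 0)) ` S \<subseteq> B" "(0, 1) \<in> B" "B \<subseteq> carrier T"
  shows "generate T B = carrier T"
proof
  interpret T: group T unfolding T_def by (rule DirProd_group) simp_all
  show "generate T B \<subseteq> carrier T" using B(3) by (rule T.generate_incl)
  interpret i: group_hom "free_Abelian_group S" T "\<lambda>c. (c, 0)"
    unfolding group_hom_def group_hom_axioms_def
    using T.group_axioms by (auto simp: T_def hom_def)
  have free: "(c, 0) \<in> generate T B" if "c \<in> carrier (free_Abelian_group S)" for c
  proof -
    have "(c, 0) \<in> generate T ((\<lambda>c. (c, 0)) ` frag_of ` S)"
      using that by (subst i.generate_img) (auto simp: generate_free_Abelian_group)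
    also have "\<dots> \<subseteq> generate T B"
      using B(1) by (intro T.mono_generate) auto
    finally show ?thesis .
  qed
  show "carrier T \<subseteq> generate T B"
  proof
    fix p assume "p \<in> carrier T"
    then obtain c m where p: "p = (c, m)" "c \<in> carrier (free_Abelian_group S)" "m \<in> {0..<2}"
      by (auto simp: T_def carrier_integer_mod_group)
    then have "m = 0 \<or> m = 1" by auto
    then have "(0, m) \<in> generate T B"
      using free[of 0] B(2) by (auto intro: generate.incl)
    then have "(c, 0) \<otimes>\<^bsub>T\<^esub> (0, m) \<in> generate T B"
      by (intro generate.eng free p(2))
    then show "p \<in> generate T B" using p by (auto simp: T_def)
  qed
qed

lemma card_AB_Z_gens: "card (AB_gens g \<union> Z_gens n :: 's surface_gen set) = 2 * g + n"
proof -
  have "card (AB_gens g :: 's surface_gen set) = 2 * g"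
    unfolding AB_gens_def
    by (subst card_Un_disjoint) (auto simp: card_image inj_on_def)
  moreover have "card (Z_gens n :: 's surface_gen set) = n"
    unfolding Z_gens_def by (simp add: card_image inj_on_def)
  moreover have "AB_gens g \<inter> (Z_gens n :: 's surface_gen set) = {}"
    by (auto simp: AB_gens_def Z_gens_def)
  ultimately show ?thesis
    by (subst card_Un_disjoint) (auto simp: AB_gens_def Z_gens_def)
qed

section \<open>Abelianized surface braid groups\<close>

lemma abel_name_image_braid_gens:
  assumes "k \<ge> 1"
  shows "abel_name ` braid_gens k g n = abel_gens k g n"
proof -
  have "abel_name ` (AB_gens g :: nat surface_gen set) = AB_gens g"
    "abel_name ` (Z_gens n :: nat surface_gen set) = Z_gens n"
    by (simp_all add: AB_gens_def Z_gens_def image_Un image_image)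
  moreover have "abel_name ` Sig ` {1..<k} = (if k = 1 then {} else {Sig ()})"
    using assms by (auto simp: image_image image_constant_conv)
  ultimately show ?thesis
    by (simp add: braid_gens_def abel_gens_def image_Un)
qed

text \<open>For \<open>k = 1\<close> the value at \<open>Sig ()\<close> is junk, as \<open>Sig 1\<close> is then not a generator.\<close>
definition abel_gen :: "('g, 'm) monoid_scheme \<Rightarrow> (nat surface_gen \<Rightarrow> 'g) \<Rightarrow> unit surface_gen \<Rightarrow> 'g set" where
  "abel_gen G \<gamma> y = abel_proj G (\<gamma> (map_surface_gen (\<lambda>_. 1) y))"

section \<open>Groups presented like a surface braid group\<close>

context
  fixes G :: "('g, 'm) monoid_scheme" and \<gamma> :: "nat surface_gen \<Rightarrow> 'g" and k g n :: nat
  assumes G: "group G" and k: "k \<ge> 1"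
    and pres: "has_presentation G \<gamma> (braid_gens k g n) (braid_rels k g n)"
begin

lemma abel_proj_gens: "(\<lambda>x. abel_proj G (\<gamma> x)) \<in> braid_gens k g n \<rightarrow> carrier (abelianization G)"
proof -
  interpret group_hom G "abelianization G" "abel_proj G"
    by (rule group_hom_abel_proj[OF G])
  show ?thesis
    using has_presentation_closed[OF G pres] by (auto intro!: hom_closed)
qed

text \<open>The relations of \<open>G\<close> persist in its commutative quotient, where
  \<open>satisfies_braid_rels_iff\<close> reads off what they mean.\<close>

lemma abel_proj_rels:
  "\<And>i. i \<in> {1..<k} \<Longrightarrow> abel_proj G (\<gamma> (Sig i)) = abel_proj G (\<gamma> (Sig 1))"
  "g \<ge> 1 \<Longrightarrow> k \<noteq> 1 \<Longrightarrow>
    abel_proj G (\<gamma> (Sig 1)) \<otimes>\<^bsub>abelianization G\<^esub> abel_proj G (\<gamma> (Sig 1)) = \<one>\<^bsub>abelianization G\<^esub>"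
proof -
  interpret group_hom G "abelianization G" "abel_proj G"
    by (rule group_hom_abel_proj[OF G])
  interpret A: comm_group "abelianization G"
    by (rule comm_group_abelianization[OF G])
  have "satisfies_rels (abelianization G) (\<lambda>x. abel_proj G (\<gamma> x)) (braid_gens k g n) (braid_rels k g n)"
    using satisfies_rels_hom[OF G group_abelianization[OF G] homh has_presentation_closed[OF G pres]
        has_presentation_satisfies[OF G pres]] .
  then show "\<And>i. i \<in> {1..<k} \<Longrightarrow> abel_proj G (\<gamma> (Sig i)) = abel_proj G (\<gamma> (Sig 1))"
    "g \<ge> 1 \<Longrightarrow> k \<noteq> 1 \<Longrightarrow>
    abel_proj G (\<gamma> (Sig 1)) \<otimes>\<^bsub>abelianization G\<^esub> abel_proj G (\<gamma> (Sig 1)) = \<one>\<^bsub>abelianization G\<^esub>"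
    unfolding A.satisfies_braid_rels_iff[OF abel_proj_gens k] by blast+
qed

text \<open>The projection depends only on the name: \<open>abel_name\<close> merges all
  \<open>Sig i\<close>, and by \<open>abel_proj_rels\<close> so does the projection.\<close>

lemma abel_proj_eq_abel_gen:
  assumes "x \<in> braid_gens k g n"
  shows "abel_proj G (\<gamma> x) = abel_gen G \<gamma> (abel_name x)"
proof (cases x)
  case (Sig i)
  then have "i \<in> {1..<k}"
    using assms by (auto simp: braid_gens_def AB_gens_def Z_gens_def)
  then show ?thesis
    using abel_proj_rels(1)[of i] Sig by (simp add: abel_gen_def)
qed (simp_all add: abel_gen_def)

lemma abel_gen_image: "abel_gen G \<gamma> ` abel_gens k g n = abel_proj G ` \<gamma> ` braid_gens k g n"
  unfolding abel_name_image_braid_gens[OF k, symmetric] image_image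
  by (rule image_cong) (simp_all add: abel_proj_eq_abel_gen)

lemma abel_gen_closed: "abel_gen G \<gamma> \<in> abel_gens k g n \<rightarrow> carrier (abelianization G)"
proof -
  have "abel_gen G \<gamma> ` abel_gens k g n \<subseteq> carrier (abelianization G)"
    unfolding abel_gen_image image_image by (rule funcset_image[OF abel_proj_gens])
  then show ?thesis by blast
qed

lemma abel_gen_generate:
  "generate (abelianization G) (abel_gen G \<gamma> ` abel_gens k g n) = carrier (abelianization G)"
  unfolding abel_gen_image
  using G funcset_image[OF has_presentation_closed[OF G pres]] has_presentation_generate[OF G pres]
  by (rule generate_abelianization)

lemma abel_gen_Sig_square:
  assumes "g \<ge> 1" "k \<noteq> 1"
  shows "abel_gen G \<gamma> (Sig ()) \<otimes>\<^bsub>abelianization G\<^esub> abel_gen G \<gamma> (Sig ()) = \<one>\<^bsub>abelianization G\<^esub>"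
  using abel_proj_rels(2)[OF assms] by (simp add: abel_gen_def)

text \<open>The common core of the three identifications below. The universal property of the
  Abelianization supplies a map back to \<open>T\<close>, inverse to \<open>h\<close> on generators;
  each candidate \<open>T\<close> only has to provide \<open>h\<close>.\<close>

lemma abel_gen_iso:
  assumes T: "comm_group T" and t: "t \<in> abel_gens k g n \<rightarrow> carrier T"
    and gen: "generate T (t ` abel_gens k g n) = carrier T"
    and sq: "g \<ge> 1 \<Longrightarrow> k \<noteq> 1 \<Longrightarrow> t (Sig ()) \<otimes>\<^bsub>T\<^esub> t (Sig ()) = \<one>\<^bsub>T\<^esub>"
    and h: "h \<in> hom T (abelianization G)" "\<And>y. y \<in> abel_gens k g n \<Longrightarrow> h (t y) = abel_gen G \<gamma> y"
  shows "h \<in> iso T (abelianization G)"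
proof -
  interpret T: comm_group T by (rule T)
  interpret A: comm_group "abelianization G"
    by (rule comm_group_abelianization[OF G])
  have name: "abel_name x \<in> abel_gens k g n" if "x \<in> braid_gens k g n" for x
    using that abel_name_image_braid_gens[OF k, of g n] by blast
  have t': "(\<lambda>x. t (abel_name x)) \<in> braid_gens k g n \<rightarrow> carrier T"
    using t name by auto
  \<comment> \<open>Pulling \<open>t\<close> back along \<open>abel_name\<close> gives all
    \<open>Sig i\<close> one value, so the first condition holds trivially.\<close>
  have sat: "satisfies_rels T (\<lambda>x. t (abel_name x)) (braid_gens k g n) (braid_rels k g n)"
    unfolding T.satisfies_braid_rels_iff[OF t' k] using sq by simp
  obtain l where l: "l \<in> hom (abelianization G) T"
      "\<And>x. x \<in> braid_gens k g n \<Longrightarrow> l (abel_proj G (\<gamma> x)) = t (abel_name x)"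
    by (rule abelianization_presentation_universal[OF G pres T t' sat]) (rule that)
  have "l (abel_gen G \<gamma> y) = t y" if mem: "y \<in> abel_gens k g n" for y
  proof -
    obtain x where x: "x \<in> braid_gens k g n" and y: "y = abel_name x"
      using mem unfolding abel_name_image_braid_gens[OF k, symmetric] by auto
    show ?thesis
      using l(2)[OF x] unfolding abel_proj_eq_abel_gen[OF x] y .
  qed
  then show ?thesis
    using iso_by_generators[OF T.group_axioms group_abelianization[OF G] t gen abel_gen_closed abel_gen_generate h l(1)]
    by simp
qed

text \<open>Here \<open>T\<close> is the presented group itself, and \<open>h\<close> comes from von
  Dyck's theorem.\<close>

lemma has_presentation_abelianization:
  "has_presentation (abelianization G) (abel_gen G \<gamma>) (abel_gens k g n) (abel_rels k g n)"
proof -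
  let ?Y = "abel_gens k g n" and ?R = "abel_rels k g n"
  interpret A: comm_group "abelianization G"
    by (rule comm_group_abelianization[OF G])
  interpret P: comm_group "presented_group ?Y ?R"
    by (rule comm_group_presented_abel)
  have "satisfies_rels (abelianization G) (abel_gen G \<gamma>) ?Y ?R"
    unfolding A.satisfies_abel_rels_iff[OF abel_gen_closed] using abel_gen_Sig_square by blast
  then obtain h where h: "h \<in> hom (presented_group ?Y ?R) (abelianization G)"
      "\<And>y. y \<in> ?Y \<Longrightarrow> h (gen_class ?Y ?R y) = abel_gen G \<gamma> y"
    using A.presented_group_universal[OF abel_gen_closed] by blast
  have "h \<in> iso (presented_group ?Y ?R) (abelianization G)"
  proof (rule abel_gen_iso[OF P.comm_group_axioms gen_class_closed generate_presented_group _ h])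
    show "gen_class ?Y ?R (Sig ()) \<otimes>\<^bsub>presented_group ?Y ?R\<^esub> gen_class ?Y ?R (Sig ()) = \<one>\<^bsub>presented_group ?Y ?R\<^esub>"
      if "g \<ge> 1" "k \<noteq> 1"
      using P.satisfies_abel_rels_iff[OF gen_class_closed] satisfies_rels_presented_group[of ?Y ?R] that
      by blast
  qed
  with h(2) show ?thesis
    unfolding has_presentation_def by blast
qed

text \<open>In both cases the square condition of \<open>abel_gen_iso\<close> is vacuous. The case
  \<open>k = 1\<close> with arbitrary \<open>g\<close> yields the torsion-free group of rank
  \<open>2 * g + n\<close>.\<close>

lemma free_Abelian_on_abelianization:
  assumes "g = 0 \<or> k = 1"
  shows "free_Abelian_on (abelianization G) (abel_gen G \<gamma>) (abel_gens k g n)"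
proof -
  let ?Y = "abel_gens k g n"
  interpret A: comm_group "abelianization G"
    by (rule comm_group_abelianization[OF G])
  obtain h where h: "h \<in> hom (free_Abelian_group ?Y) (abelianization G)"
      "\<And>y. y \<in> ?Y \<Longrightarrow> h (frag_of y) = abel_gen G \<gamma> y"
    using A.free_Abelian_group_universal[OF funcset_image[OF abel_gen_closed]] by blast
  have "h \<in> iso (free_Abelian_group ?Y) (abelianization G)"
    using assms
    by (intro abel_gen_iso[OF abelian_free_Abelian_group _ generate_free_Abelian_group _ h]) auto
  with h(2) show ?thesis
    unfolding free_Abelian_on_def by blast
qed

text \<open>The element \<sigma> has order dividing 2 and generates the finite factor; that its
  order is exactly 2 comes out of the isomorphism.\<close>

lemma abelianization_iso_times_Z2:
  assumes gk: "g \<ge> 1" "k \<noteq> 1"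
  shows "free_Abelian_group (AB_gens g \<union> Z_gens n :: unit surface_gen set) \<times>\<times> integer_mod_group 2
    \<cong> abelianization G"
proof -
  let ?S = "AB_gens g \<union> Z_gens n :: unit surface_gen set" and ?A = "abelianization G"
  let ?T = "free_Abelian_group ?S \<times>\<times> integer_mod_group 2"
  let ?s = "abel_gen G \<gamma> (Sig ())"
  \<comment> \<open>The generator \<sigma> goes to the nontrivial element of the factor of order 2,
    the others to the basis of the free factor.\<close>
  define t where "t y = (if y = Sig () then (0, 1) else (frag_of y, 0 :: int))" for y :: "unit surface_gen"
  interpret A: comm_group ?A
    by (rule comm_group_abelianization[OF G])
  have Y: "abel_gens k g n = insert (Sig ()) ?S" "Sig () \<notin> ?S"
    using gk by (auto simp: abel_gens_def AB_gens_def Z_gens_def)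
  have s: "?s \<in> carrier ?A" "?s \<otimes>\<^bsub>?A\<^esub> ?s = \<one>\<^bsub>?A\<^esub>"
    using funcset_mem[OF abel_gen_closed, of "Sig ()"] Y(1) abel_gen_Sig_square[OF gk] by simp_all
  have S: "abel_gen G \<gamma> ` ?S \<subseteq> carrier ?A"
    using funcset_image[OF abel_gen_closed] unfolding Y(1) by simp
  obtain h where h: "h \<in> hom (free_Abelian_group ?S) ?A"
      "\<And>y. y \<in> ?S \<Longrightarrow> h (frag_of y) = abel_gen G \<gamma> y"
    by (rule A.free_Abelian_group_universal[OF S]) (rule that)
  interpret h: group_hom "free_Abelian_group ?S" ?A h
    unfolding group_hom_def group_hom_axioms_def using h(1) group_abelianization[OF G] by simp
  \<comment> \<open>The homomorphism from the integers mod 2, represented by 0 and 1, that sends 1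
    to \<sigma>.\<close>
  define e where "e m = (if m = 0 then \<one>\<^bsub>?A\<^esub> else ?s)" for m :: int
  \<comment> \<open>The product of two homomorphisms is again one because the target is
    commutative.\<close>
  define h' where "h' p = h (fst p) \<otimes>\<^bsub>?A\<^esub> e (snd p)" for p
  have e: "e m \<in> carrier ?A" for m using s by (simp add: e_def)
  \<comment> \<open>The square relation enters in the case \<open>m = m' = 1\<close>, where the sum
    wraps around to 0.\<close>
  have e_add: "e ((m + m') mod 2) = e m \<otimes>\<^bsub>?A\<^esub> e m'" if "m \<in> {0..<2}" "m' \<in> {0..<2}" for m m'
  proof -
    have "m = 0 \<or> m = 1" "m' = 0 \<or> m' = 1" using that by auto
    then show ?thesis using s by - (elim disjE; simp add: e_def)
  qed
  have "h' \<in> iso ?T ?A"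
  proof (rule abel_gen_iso[where t = t])
    show T: "comm_group ?T"
    proof -
      interpret T: group ?T by (rule DirProd_group) simp_all
      show ?thesis
        by (rule T.group_comm_groupI) (auto simp: add.commute)
    qed
    show t: "t \<in> abel_gens k g n \<rightarrow> carrier ?T"
      using Y by (auto simp: t_def)
    show "generate ?T (t ` abel_gens k g n) = carrier ?T"
    proof (rule generate_free_Abelian_group_times_Z2)
      show "(\<lambda>x. (frag_of x, 0)) ` ?S \<subseteq> t ` abel_gens k g n"
        using Y by (force simp: t_def)
      show "(0, 1) \<in> t ` abel_gens k g n"
        using Y by (force simp: t_def)
      show "t ` abel_gens k g n \<subseteq> carrier ?T"
        by (rule funcset_image[OF t])
    qed
    show "t (Sig ()) \<otimes>\<^bsub>?T\<^esub> t (Sig ()) = \<one>\<^bsub>?T\<^esub>"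
      by (simp add: t_def)
    show "h' \<in> hom ?T ?A"
    proof (rule homI)
      fix p assume "p \<in> carrier ?T"
      then show "h' p \<in> carrier ?A"
        unfolding h'_def by (intro A.m_closed e h.hom_closed) auto
    next
      fix p p' assume p: "p \<in> carrier ?T" "p' \<in> carrier ?T"
      then have c: "fst p \<in> carrier (free_Abelian_group ?S)" "fst p' \<in> carrier (free_Abelian_group ?S)"
        and m: "snd p \<in> {0..<2}" "snd p' \<in> {0..<2}"
        by (auto simp: carrier_integer_mod_group)
      show "h' (p \<otimes>\<^bsub>?T\<^esub> p') = h' p \<otimes>\<^bsub>?A\<^esub> h' p'"
        using h.hom_mult[OF c] h.hom_closed[OF c(1)] h.hom_closed[OF c(2)] e e_add[OF m]
        by (simp add: h'_def mult_DirProd' A.m_ac)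
    qed
    show "h' (t y) = abel_gen G \<gamma> y" if "y \<in> abel_gens k g n" for y
    proof (cases "y = Sig ()")
      case True
      then show ?thesis using h.hom_one s by (simp add: h'_def t_def e_def)
    next
      case False
      then show ?thesis using that Y h(2)[of y] h.hom_closed[of "frag_of y"] by (simp add: h'_def t_def e_def)
    qed
  qed
  then show ?thesis by (auto simp: is_iso_def)
qed

end

theorem proposition3p4:
  fixes k g n :: nat
    and \<Sigma> :: "'a topology"
    and q :: "(nat \<Rightarrow> 'a) set"
    and G :: "(real \<Rightarrow> (nat \<Rightarrow> 'a) set) set monoid"
    and \<gamma> :: "nat surface_gen \<Rightarrow> (real \<Rightarrow> (nat \<Rightarrow> 'a) set) set"
  assumes "k \<ge> 1"
    and "punctured_bounded_surface g n \<Sigma>"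
    and "q \<in> topspace (unordered_config_space k \<Sigma>)"
    and "G = surface_braid_group k \<Sigma> q"
    and "has_presentation G \<gamma> (braid_gens k g n) (braid_rels k g n)"
  shows "(\<exists>\<delta>. (\<forall>x\<in>braid_gens k g n. abel_proj G (\<gamma> x) = \<delta> (abel_name x)) \<and>
              abel_name ` braid_gens k g n = abel_gens k g n \<and>
              has_presentation (abelianization G) \<delta> (abel_gens k g n) (abel_rels k g n) \<and>
              (g = 0 \<longrightarrow> free_Abelian_on (abelianization G) \<delta> (abel_gens k g n))) \<and>
         (g \<ge> 1 \<and> k \<ge> 2 \<longrightarrow>
              abelianization G \<cong>
                product_group {..<2 * g + n} (\<lambda>_. integer_group) \<times>\<times> integer_mod_group 2) \<and>
         (g \<ge> 1 \<and> k = 1 \<longrightarrow>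
              abelianization G \<cong> product_group {..<2 * g + n} (\<lambda>_. integer_group))"
proof -
  have G: "group G"
    using assms(3,4) by (simp add: surface_braid_group_def group_fundamental_group)
  note hyps = G assms(1,5)
  let ?S = "AB_gens g \<union> Z_gens n :: unit surface_gen set"
  let ?Zm = "product_group {..<2 * g + n} (\<lambda>_. integer_group)"
  have "finite ?S" by (simp add: AB_gens_def Z_gens_def)
  from free_Abelian_group_finite_iso[OF this] have free: "free_Abelian_group ?S \<cong> ?Zm"
    by (simp only: card_AB_Z_gens)
  have "abelianization G \<cong> ?Zm \<times>\<times> integer_mod_group 2" if "g \<ge> 1" "k \<ge> 2"
  proof -
    have "abelianization G \<cong> free_Abelian_group ?S \<times>\<times> integer_mod_group 2"
      using that by (intro group.iso_sym[OF _ abelianization_iso_times_Z2[OF hyps]] DirProd_group) simp_all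
    also have "\<dots> \<cong> ?Zm \<times>\<times> integer_mod_group 2"
      by (intro group.DirProd_iso_trans free iso_refl) simp_all
    finally show ?thesis .
  qed
  moreover have "abelianization G \<cong> ?Zm" if "k = 1"
  proof -
    \<comment> \<open>For \<open>k = 1\<close> the generator \<sigma> is suppressed, so
      \<open>abel_gens k g n\<close> is exactly \<open>?S\<close>.\<close>
    have "free_Abelian_group ?S \<cong> abelianization G"
      using free_Abelian_on_abelianization[OF hyps] that
      by (auto simp: free_Abelian_on_def abel_gens_def is_iso_def)
    then have "abelianization G \<cong> free_Abelian_group ?S"
      by (rule group.iso_sym[rotated]) simp
    also note free
    finally show ?thesis .
  qed
  \<comment> \<open>The witness for \<open>\<delta>\<close> is
    \<open>abel_gen G \<gamma>\<close>.\<close>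
  ultimately show ?thesis
    using abel_proj_eq_abel_gen[OF hyps] abel_name_image_braid_gens[OF assms(1), of g n]
      has_presentation_abelianization[OF hyps] free_Abelian_on_abelianization[OF hyps]
    by blast
qed

end
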